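(* Let $\mu\in\mathbb R$ and let $B^\mu$ be a Brownian motion with drift $\mu$ started at $0$. For $t>0$ let ${}^{\mu}T_{0,t}=\sup\{s<t: B^\mu(s)=0\}$. Then for every $0<a<t<\infty$, $$P\{{}^{\mu}T_{0,t}<a\}=1-\int_0^{t-a}\frac{1}{\pi(a+s)}\sqrt{\frac as}\,e^{-\frac{\mu^2}{2}(a+s)}\,ds =1-\frac2\pi\int_0^{\sqrt{\frac{t-a}{a}}}\frac{e^{-\frac{\mu^2a}{2}(1+y^2)}}{1+y^2}\,dy$$ $$=1-\frac2\pi e^{-\frac{\mu^2a}{2}}\int_0^{\arccos\sqrt{a/t}}e^{-\frac{\mu^2a}{2}\tan^2\theta}\,d\theta .$$ Furthermore, ${}^{\mu}T_{0,t}$ has a density on $(0,t)$ given by $$\frac{P\{{}^{\mu}T_{0,t}\in da\}}{da}=\frac{e^{-\frac{\mu^2t}{2}}}{\pi\sqrt{a(t-a)}}+\frac{\mu^2}{\pi}\int_0^{\sqrt{\frac{t-a}{a}}}e^{-\frac{\mu^2a}{2}(1+y^2)}\,dy =\frac{e^{-\frac{\mu^2t}{2}}}{\pi\sqrt{a(t-a)}}+\frac{\mu^2}{2\pi}\int_a^t\frac{e^{-\frac{\mu^2y}{2}}}{\sqrt{a(y-a)}}\,dy .$$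
   Context: A Brownian motion with drift $\mu$ started at $0$ is $B^\mu(s)=B(s)+\mu s$, $s\ge 0$, with $B$ a standard one-dimensional Brownian motion, $B(0)=0$. The supremum is over $s\in[0,t)$; the set contains $s=0$, so ${}^{\mu}T_{0,t}$ is well defined with values in $[0,t]$. *)

theory Defs
  imports "HOL-Probability.Probability"
begin

text \<open>
  Time is modelled by the type of all reals, but only the values \<open>B s\<close> with \<open>s \<ge> 0\<close> are
  constrained. As usual, \<open>B 0 = 0\<close> and continuity are required of every path, so that
  functionals such as the last zero before time \<open>t\<close> are defined at every sample point.
\<close>

locale standard_brownian_motion = prob_space M for M :: "'a measure" +
  fixes B :: "real \<Rightarrow> 'a \<Rightarrow> real"
  assumes random_variable_B: "\<And>s. 0 \<le> s \<Longrightarrow> random_variable borel (B s)"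
    and start_at_0: "\<And>\<omega>. \<omega> \<in> space M \<Longrightarrow> B 0 \<omega> = 0"
    and continuous_paths: "\<And>\<omega>. \<omega> \<in> space M \<Longrightarrow> continuous_on {0..} (\<lambda>s. B s \<omega>)"
    and normal_increments: "\<And>r s. 0 \<le> r \<Longrightarrow> r < s \<Longrightarrow>
      distributed M lborel (\<lambda>\<omega>. B s \<omega> - B r \<omega>)
        (\<lambda>x. ennreal (normal_density 0 (sqrt (s - r)) x))"
    and independent_increments: "\<And>(\<tau> :: nat \<Rightarrow> real) n.
      0 \<le> \<tau> 0 \<Longrightarrow> (\<forall>i<n. \<tau> i < \<tau> (Suc i)) \<Longrightarrow>
      indep_vars (\<lambda>_. borel) (\<lambda>i \<omega>. B (\<tau> (Suc i)) \<omega> - B (\<tau> i) \<omega>) {..<n}"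

definition brownian_motion_with_drift ::
    "'a measure \<Rightarrow> real \<Rightarrow> (real \<Rightarrow> 'a \<Rightarrow> real) \<Rightarrow> bool" where
  "brownian_motion_with_drift M \<mu> X \<longleftrightarrow>
    (\<exists>B. standard_brownian_motion M B \<and>
         (\<forall>s\<ge>0. \<forall>\<omega>\<in>space M. X s \<omega> = B s \<omega> + \<mu> * s))"

definition last_zero_before :: "(real \<Rightarrow> 'a \<Rightarrow> real) \<Rightarrow> real \<Rightarrow> 'a \<Rightarrow> real" where
  "last_zero_before X t \<omega> = Sup {s. 0 \<le> s \<and> s < t \<and> X s \<omega> = 0}"

end

theory Submission
  imports Defs "HOL-Real_Asymp.Real_Asymp"
begin

text \<open>
  Up to null events, the last zero before \<open>t\<close> is at least \<open>a\<close> iff \<open>X\<close> has a zero in \<open>[a, t]\<close>. If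
  \<open>Z\<close> is normal with mean \<open>\<mu> u\<close> and variance \<open>u\<close>, then \<open>E (f Z) = E (f (- Z) * exp (- 2 * \<mu> * Z))\<close>, and
  this identity does not involve \<open>u\<close>. It may therefore be applied to \<open>X t - X \<sigma>\<close>, where \<open>\<sigma>\<close> is the first
  point of a dyadic grid at which a path with \<open>X a < c\<close> has reached \<open>c\<close>. As the mesh shrinks,
  \<open>X \<sigma>\<close> tends to \<open>c\<close>; this yields the reflection principle with drift and expresses the
  probability of reaching \<open>c\<close> by the joint law of \<open>X a\<close> and \<open>X t\<close>. Letting \<open>c\<close> increase to \<open>0\<close>
  shows that paths touching \<open>0\<close> without crossing do not matter. The remaining
  Gaussian integral is evaluated through the first passage density and Tonelli's theorem.
  The density of the last zero follows by a second application of Tonelli's theorem, using that \<open>2 * arccos (sqrt (a / y))\<close> is both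
  the integral of \<open>1 / sqrt (b * (y - b))\<close> over \<open>b\<close> in \<open>(a, y)\<close> and
  the integral of \<open>sqrt (a / (r - a)) / r\<close> over \<open>r\<close> in \<open>(a, y)\<close>.
\<close>

section \<open>Gaussian tails and first passage densities\<close>

text \<open>Reflection usually rests on the strong Markov property and, with drift, on Girsanov's
  theorem. Here both are replaced by finitely many increments: on a grid the first crossing splits
  into disjoint events, each independent of the later displacement, and the weight
  \<open>exp (- 2 * \<mu> * Z)\<close>, the ratio of the normal densities with drifts
  \<open>- \<mu>\<close> and \<open>\<mu>\<close>, is the same for every grid point, so that the
  identities add up. Only paths below 0 at time \<open>a\<close> are treated; the others are covered
  by \<open>- X\<close>, which has drift \<open>- \<mu>\<close>, and since the result is even in
  \<open>\<mu>\<close> this doubles it. A grid notices a sign change but may miss a touch of 0 from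
  below, so the event of interest is enclosed between a smaller and a larger one. The singular
  kernels are integrated in \<open>ennreal\<close>, where Tonelli's theorem asks for no
  integrability. The density is not found by differentiating the distribution function: tail and
  integrated density are reduced to one common expression. The tail formula holds for positive
  \<open>a\<close> only; that the density has total mass 1 settles the point 0.\<close>

lemma nn_integral_FTC_interior:
  fixes f F :: "real \<Rightarrow> real"
  assumes "a \<le> b"
    and "continuous_on {a..b} F"
    and deriv: "\<And>x. a < x \<Longrightarrow> x < b \<Longrightarrow> (F has_real_derivative f x) (at x)"
    and [measurable]: "f \<in> borel_measurable borel"
    and nonneg: "\<And>x. a < x \<Longrightarrow> x < b \<Longrightarrow> 0 \<le> f x"
  shows "(\<integral>\<^sup>+x\<in>{a<..<b}. ennreal (f x) \<partial>lborel) = ennreal (F b - F a)"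
proof -
  \<comment> \<open>The kernels treated later blow up at an end of the interval while their
    antiderivatives stay continuous. Cutting off to the open interval makes the integrand
    nonnegative everywhere and avoids the endpoints.\<close>
  let ?g = "\<lambda>x. f x * indicator {a<..<b} x"
  have "(?g has_integral (F b - F a)) {a..b}"
    using assms(1,2) by (rule fundamental_theorem_of_calculus_interior)
      (auto simp: has_real_derivative_iff_has_vector_derivative[symmetric] intro!: deriv)
  then have "((\<lambda>x. if x \<in> {a..b} then ?g x else 0) has_integral (F b - F a)) UNIV"
    by (simp only: has_integral_restrict_UNIV)
  also have "(\<lambda>x. if x \<in> {a..b} then ?g x else 0) = ?g"
    by (auto simp: fun_eq_iff)
  finally have "(\<integral>\<^sup>+x. ennreal (?g x) \<partial>lborel) = ennreal (F b - F a)"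
    by (intro nn_integral_has_integral_lborel) (auto simp: nonneg indicator_def)
  then show ?thesis
    by (simp add: ennreal_mult'' ennreal_indicator)
qed

text \<open>The cdf is given only as the measure of half-lines. Its increments agree with those of
  an antiderivative \<open>F\<close> of the continuous density, so the two differ by the constant
  \<open>C\<close>.\<close>

lemma DERIV_cdf_std_normal_distribution:
  "(cdf std_normal_distribution has_real_derivative std_normal_density z) (at z)"
proof -
  interpret real_distribution std_normal_distribution
    by (rule real_dist_normal_dist)
  have "continuous_on UNIV std_normal_density"
    unfolding std_normal_density_def by (intro continuous_intros) auto
  then have "isCont std_normal_density x" for x
    by (simp add: continuous_on_eq_continuous_at)
  then obtain F where F: "\<And>x. (F has_real_derivative std_normal_density x) (at x)"
    using einterval_antiderivative[of "-\<infinity>" "\<infinity>" std_normal_density]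
    by (auto simp: has_real_derivative_iff_has_vector_derivative)
  have mono: "cdf std_normal_distribution y - cdf std_normal_distribution x = F y - F x" if "x \<le> y" for x y
  proof -
    have "F x \<le> F y"
      by (rule DERIV_nonneg_imp_nondecreasing[OF that]) (metis F normal_density_nonneg)
    have "emeasure std_normal_distribution {x<..y} = (\<integral>\<^sup>+z\<in>{x<..y}. std_normal_density z \<partial>lborel)"
      by (simp add: emeasure_density)
    also have "\<dots> = (\<integral>\<^sup>+z\<in>{x<..<y}. std_normal_density z \<partial>lborel)"
      by (intro nn_integral_cong_AE) (use AE_lborel_singleton[of y] in \<open>auto split: split_indicator elim: eventually_mono\<close>)
    also have "\<dots> = ennreal (F y - F x)"
      using that F by (intro nn_integral_FTC_interior DERIV_atLeastAtMost_imp_continuous_on) auto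
    finally show ?thesis
      using that \<open>F x \<le> F y\<close> by (cases "x = y") (auto simp: cdf_diff_eq emeasure_eq_measure)
  qed
  define C where "C = cdf std_normal_distribution 0 - F 0"
  have "cdf std_normal_distribution y = C + F y" for y
    using mono[of 0 y] mono[of y 0] by (cases "0 \<le> y") (auto simp: C_def)
  then have "cdf std_normal_distribution = (\<lambda>y. C + F y)" by blast
  then show ?thesis
    using DERIV_add_const[OF F[of z], of C] by simp
qed

lemma nn_integral_normal_density_greaterThan:
  assumes "0 < \<sigma>"
  shows "(\<integral>\<^sup>+v\<in>{x<..}. ennreal (normal_density m \<sigma> v) \<partial>lborel)
    = ennreal (cdf std_normal_distribution ((m - x) / \<sigma>))"
proof -
  interpret real_distribution std_normal_distribution
    by (rule real_dist_normal_dist)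
  \<comment> \<open>Substituting \<open>m - \<sigma> * z\<close> instead of
    \<open>m + \<sigma> * z\<close> turns the upper tail directly into a lower one, that is, into a
    value of the cdf.\<close>
  have "(\<integral>\<^sup>+v\<in>{x<..}. ennreal (normal_density m \<sigma> v) \<partial>lborel)
    = ennreal \<bar>- \<sigma>\<bar> * (\<integral>\<^sup>+z. ennreal (normal_density m \<sigma> (m + (- \<sigma>) * z)) * indicator {x<..} (m + (- \<sigma>) * z) \<partial>lborel)"
    by (rule nn_integral_real_affine) (use assms in auto)
  also have "\<dots> = (\<integral>\<^sup>+z. ennreal (std_normal_density z) * indicator {..<(m - x) / \<sigma>} z \<partial>lborel)"
  proof (subst nn_integral_cmult[symmetric])
    have "ennreal \<bar>- \<sigma>\<bar> * (ennreal (normal_density m \<sigma> (m + - \<sigma> * z)) * indicator {x<..} (m + - \<sigma> * z))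
        = ennreal (std_normal_density z) * indicator {..<(m - x) / \<sigma>} z" for z
    proof -
      have "\<sigma> * normal_density m \<sigma> (m + - \<sigma> * z) = std_normal_density z"
        using assms by (simp add: normal_density_def power_mult_distrib real_sqrt_mult)
      then have "ennreal \<bar>- \<sigma>\<bar> * ennreal (normal_density m \<sigma> (m + - \<sigma> * z)) = ennreal (std_normal_density z)"
        using assms by (simp flip: ennreal_mult)
      moreover have "indicator {x<..} (m + - \<sigma> * z) = (indicator {..<(m - x) / \<sigma>} z :: ennreal)"
        using assms by (auto simp: indicator_def field_simps)
      ultimately show ?thesis by (simp add: mult.assoc[symmetric])
    qed
    then show "(\<integral>\<^sup>+z. ennreal \<bar>- \<sigma>\<bar> * (ennreal (normal_density m \<sigma> (m + - \<sigma> * z)) * indicator {x<..} (m + - \<sigma> * z)) \<partial>lborel)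
      = (\<integral>\<^sup>+z. ennreal (std_normal_density z) * indicator {..<(m - x) / \<sigma>} z \<partial>lborel)" by simp
  qed auto
  also have "\<dots> = (\<integral>\<^sup>+z. ennreal (std_normal_density z) * indicator {..(m - x) / \<sigma>} z \<partial>lborel)"
    by (intro nn_integral_cong_AE) (use AE_lborel_singleton[of "(m - x) / \<sigma>"] in \<open>auto split: split_indicator elim: eventually_mono\<close>)
  also have "\<dots> = ennreal (cdf std_normal_distribution ((m - x) / \<sigma>))"
    by (simp add: cdf_def emeasure_eq_measure[symmetric] emeasure_density)
  finally show ?thesis .
qed

text \<open>The density in \<open>r\<close> of the first time at which Brownian motion with drift \<open>\<mu>\<close> started at \<open>0\<close> hits \<open>x > 0\<close>.\<close>

definition passage_density :: "real \<Rightarrow> real \<Rightarrow> real \<Rightarrow> real" where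
  "passage_density \<mu> x r = x / sqrt (2 * pi * r ^ 3) * exp (- (x - \<mu> * r)\<^sup>2 / (2 * r))"

lemma nn_integral_passage_density:
  assumes "0 < x" "0 < s"
  shows "(\<integral>\<^sup>+v\<in>{x<..}. ennreal (normal_density (\<mu> * s) (sqrt s) v * (1 + exp (- 2 * \<mu> * (v - x)))) \<partial>lborel)
    = (\<integral>\<^sup>+r\<in>{0<..<s}. ennreal (passage_density \<mu> x r) \<partial>lborel)"
proof -
  \<comment> \<open>By the reflection formula, both sides are the probability of hitting \<open>x\<close> before time \<open>s\<close>.\<close>
  interpret real_distribution std_normal_distribution
    by (rule real_dist_normal_dist)
  let ?\<Phi> = "cdf std_normal_distribution"
  \<comment> \<open>The Bachelier-Levy formula for the distribution function of the passage time.
    Both arguments of the cdf tend to minus infinity as \<open>r\<close> decreases to 0, whence the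
    value 0 there.\<close>
  define F where "F r = (if r \<le> 0 then 0 else ?\<Phi> (\<mu> * sqrt r - x / sqrt r) + exp (2 * \<mu> * x) * ?\<Phi> (- \<mu> * sqrt r - x / sqrt r))" for r
  \<comment> \<open>Up to the constant \<open>exp (2 * \<mu> * x)\<close>, the weight replaces the
    drift \<open>\<mu>\<close> by \<open>- \<mu>\<close>, so each summand is a plain normal
    tail.\<close>
  have exp_factor: "normal_density (\<mu> * s) (sqrt s) v * (1 + exp (- 2 * \<mu> * (v - x)))
      = normal_density (\<mu> * s) (sqrt s) v + exp (2 * \<mu> * x) * normal_density (- \<mu> * s) (sqrt s) v" for v
  proof -
    have "- (v - \<mu> * s)\<^sup>2 / (2 * s) + (- 2 * \<mu> * (v - x)) = 2 * \<mu> * x + - (v + \<mu> * s)\<^sup>2 / (2 * s)"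
      using assms by (simp add: field_simps power2_eq_square)
    then have "exp (- (v - \<mu> * s)\<^sup>2 / (2 * s)) * exp (- 2 * \<mu> * (v - x)) = exp (2 * \<mu> * x) * exp (- (v + \<mu> * s)\<^sup>2 / (2 * s))"
      by (metis exp_add)
    then show ?thesis
      using assms by (simp add: normal_density_def field_simps)
  qed
  have "(\<integral>\<^sup>+v\<in>{x<..}. ennreal (normal_density (\<mu> * s) (sqrt s) v * (1 + exp (- 2 * \<mu> * (v - x)))) \<partial>lborel)
    = (\<integral>\<^sup>+v\<in>{x<..}. ennreal (normal_density (\<mu> * s) (sqrt s) v) \<partial>lborel)
      + ennreal (exp (2 * \<mu> * x)) * (\<integral>\<^sup>+v\<in>{x<..}. ennreal (normal_density (- \<mu> * s) (sqrt s) v) \<partial>lborel)"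
    unfolding exp_factor
    by (subst nn_integral_cmult[symmetric], simp, subst nn_integral_add[symmetric])
      (auto simp: ennreal_mult indicator_def intro!: nn_integral_cong)
  also have "\<dots> = ennreal (F s - F 0)"
  proof -
    have "(\<mu> * s - x) / sqrt s = \<mu> * sqrt s - x / sqrt s" "(- \<mu> * s - x) / sqrt s = - \<mu> * sqrt s - x / sqrt s"
      using assms by (auto simp: field_simps)
    then show ?thesis
      using assms by (simp add: nn_integral_normal_density_greaterThan F_def cdf_nonneg flip: ennreal_mult)
  qed
  also have "\<dots> = (\<integral>\<^sup>+r\<in>{0<..<s}. ennreal (passage_density \<mu> x r) \<partial>lborel)"
  proof (rule nn_integral_FTC_interior[symmetric])
    have deriv: "(F has_real_derivative passage_density \<mu> x r) (at r)" if "0 < r" for r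
    proof -
      let ?G = "\<lambda>r. ?\<Phi> (\<mu> * sqrt r - x / sqrt r) + exp (2 * \<mu> * x) * ?\<Phi> (- \<mu> * sqrt r - x / sqrt r)"
      let ?p = "\<mu> * (inverse (sqrt r) / 2)" and ?q = "x * (inverse (sqrt r) / 2) / (sqrt r * sqrt r)"
      \<comment> \<open>This makes the two chain rule terms carry the same density: the
        contributions of \<open>?p\<close> cancel and those of \<open>?q\<close> double.\<close>
      have sym: "exp (2 * \<mu> * x) * std_normal_density (- \<mu> * sqrt r - x / sqrt r) = std_normal_density (\<mu> * sqrt r - x / sqrt r)"
      proof -
        have "2 * \<mu> * x + - (- \<mu> * sqrt r - x / sqrt r)\<^sup>2 / 2 = - (\<mu> * sqrt r - x / sqrt r)\<^sup>2 / 2"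
          using that by (simp add: field_simps power2_eq_square)
        then have "exp (2 * \<mu> * x) * exp (- (- \<mu> * sqrt r - x / sqrt r)\<^sup>2 / 2) = exp (- (\<mu> * sqrt r - x / sqrt r)\<^sup>2 / 2)"
          by (metis exp_add)
        then show ?thesis
          unfolding std_normal_density_def by (metis (no_types, opaque_lifting) mult.left_commute)
      qed
      have dens: "std_normal_density (\<mu> * sqrt r - x / sqrt r) * (2 * ?q) = passage_density \<mu> x r"
      proof -
        have "- (\<mu> * sqrt r - x / sqrt r)\<^sup>2 / 2 = - (x - \<mu> * r)\<^sup>2 / (2 * r)"
          using that by (simp add: field_simps power2_eq_square)
        moreover have "sqrt (2 * pi * r ^ 3) = sqrt (2 * pi) * (sqrt r * r)"
          using that by (simp add: real_sqrt_mult power3_eq_cube)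
        ultimately show ?thesis
          using that by (simp add: std_normal_density_def passage_density_def field_simps)
      qed
      have combine: "E1 * (p + q) + e * (E2 * (- p + q)) = P"
        if "e * E2 = E1" "E1 * (2 * q) = P" for E1 E2 e p q P :: real
        unfolding that[symmetric] by (simp add: algebra_simps)
      have "(?G has_real_derivative std_normal_density (\<mu> * sqrt r - x / sqrt r) * (?p + ?q)
          + exp (2 * \<mu> * x) * (std_normal_density (- \<mu> * sqrt r - x / sqrt r) * (- ?p + ?q))) (at r)"
        using that by (auto intro!: derivative_eq_intros DERIV_chain2[OF DERIV_cdf_std_normal_distribution] simp: mult_ac)
      also have "std_normal_density (\<mu> * sqrt r - x / sqrt r) * (?p + ?q)
          + exp (2 * \<mu> * x) * (std_normal_density (- \<mu> * sqrt r - x / sqrt r) * (- ?p + ?q))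
          = passage_density \<mu> x r"
        by (rule combine[OF sym dens])
      finally have "(?G has_real_derivative passage_density \<mu> x r) (at r)" .
      moreover have "eventually (\<lambda>r. ?G r = F r) (nhds r)"
        using eventually_nhds_in_open[of "{0<..}" r] that by (auto simp: F_def elim: eventually_mono)
      ultimately show ?thesis
        using DERIV_cong_ev[of r r ?G F] by simp
    qed
    then show "\<And>r. 0 < r \<Longrightarrow> (F has_real_derivative passage_density \<mu> x r) (at r)"
      by this
    show "continuous_on {0..s} F"
    proof (intro continuous_on_eq_continuous_within[THEN iffD2] ballI)
      fix r assume r: "r \<in> {0..s}"
      show "continuous (at r within {0..s}) F"
      proof (cases "r = 0")
        case True
        have "LIM r at_right 0. \<mu> * sqrt r - x / sqrt r :> at_bot" "LIM r at_right 0. - \<mu> * sqrt r - x / sqrt r :> at_bot"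
          using assms by real_asymp+
        then have "((\<lambda>r. ?\<Phi> (\<mu> * sqrt r - x / sqrt r) + exp (2 * \<mu> * x) * ?\<Phi> (- \<mu> * sqrt r - x / sqrt r)) \<longlongrightarrow> 0 + exp (2 * \<mu> * x) * 0) (at_right 0)"
          by (intro tendsto_intros filterlim_compose[OF cdf_lim_at_bot]) 
        then have "(F \<longlongrightarrow> 0 + exp (2 * \<mu> * x) * 0) (at_right 0)"
          by (rule Lim_transform_eventually) (use eventually_at_right_less[of "0::real"] in \<open>auto simp: F_def elim: eventually_mono\<close>)
        then show ?thesis
          using True assms by (simp add: continuous_within F_def at_within_Icc_at_right)
      next
        case False
        with r have "0 < r" by simp
        then show ?thesis
          using continuous_at_imp_continuous_at_within[OF DERIV_isCont[OF deriv]] by blast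
      qed
    qed
    show "passage_density \<mu> x \<in> borel_measurable borel"
      unfolding passage_density_def by measurable
  qed (use assms in \<open>auto simp: passage_density_def\<close>)
  finally show ?thesis .
qed

lemma nn_integral_triangle_swap:
  fixes f :: "real \<Rightarrow> real \<Rightarrow> ennreal"
  assumes [measurable]: "case_prod f \<in> borel_measurable (borel \<Otimes>\<^sub>M borel)"
  shows "(\<integral>\<^sup>+x\<in>{a<..<t}. (\<integral>\<^sup>+y\<in>{x<..<t}. f x y \<partial>lborel) \<partial>lborel)
    = (\<integral>\<^sup>+y\<in>{a<..<t}. (\<integral>\<^sup>+x\<in>{a<..<y}. f x y \<partial>lborel) \<partial>lborel)"
proof -
  have "(\<integral>\<^sup>+x\<in>{a<..<t}. (\<integral>\<^sup>+y\<in>{x<..<t}. f x y \<partial>lborel) \<partial>lborel)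
    = (\<integral>\<^sup>+x. \<integral>\<^sup>+y. (if a < x \<and> x < y \<and> y < t then f x y else 0) \<partial>lborel \<partial>lborel)"
  proof (rule nn_integral_cong)
    fix x
    show "(\<integral>\<^sup>+y\<in>{x<..<t}. f x y \<partial>lborel) * indicator {a<..<t} x
      = (\<integral>\<^sup>+y. (if a < x \<and> x < y \<and> y < t then f x y else 0) \<partial>lborel)"
    proof (cases "a < x \<and> x < t")
      case False
      then have "(\<lambda>y. if a < x \<and> x < y \<and> y < t then f x y else 0) = (\<lambda>_. 0)"
        by (intro ext) auto
      with False show ?thesis by simp
    qed (auto split: split_indicator intro!: nn_integral_cong)
  qed
  also have "\<dots> = (\<integral>\<^sup>+y. \<integral>\<^sup>+x. (if a < x \<and> x < y \<and> y < t then f x y else 0) \<partial>lborel \<partial>lborel)"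
    by (rule lborel_pair.Fubini'[symmetric]) measurable
  also have "\<dots> = (\<integral>\<^sup>+y\<in>{a<..<t}. (\<integral>\<^sup>+x\<in>{a<..<y}. f x y \<partial>lborel) \<partial>lborel)"
  proof (rule nn_integral_cong)
    fix y
    show "(\<integral>\<^sup>+x. (if a < x \<and> x < y \<and> y < t then f x y else 0) \<partial>lborel)
      = (\<integral>\<^sup>+x\<in>{a<..<y}. f x y \<partial>lborel) * indicator {a<..<t} y"
    proof (cases "a < y \<and> y < t")
      case False
      then have "(\<lambda>x. if a < x \<and> x < y \<and> y < t then f x y else 0) = (\<lambda>_. 0)"
        by (intro ext) auto
      with False show ?thesis by simp
    qed (auto split: split_indicator intro!: nn_integral_cong)
  qed
  finally show ?thesis .
qed

text \<open>The path is at \<open>- x\<close> at time \<open>a\<close> and climbs to 0 after a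
  further time \<open>r\<close>. The terms of the two exponents that are linear in \<open>x\<close>
  are \<open>- \<mu> * x\<close> and \<open>\<mu> * x\<close> and cancel, which leaves a multiple of
  the elementary \<open>x * exp (- k * x\<^sup>2)\<close>.\<close>

lemma nn_integral_normal_passage_density:
  assumes "0 < a" "0 < r"
  shows "(\<integral>\<^sup>+x\<in>{0<..}. ennreal (normal_density (\<mu> * a) (sqrt a) (- x) * passage_density \<mu> x r) \<partial>lborel)
    = ennreal (1 / (2 * pi * (a + r)) * sqrt (a / r) * exp (- (\<mu>\<^sup>2 / 2) * (a + r)))"
proof -
  define k where "k = (a + r) / (2 * a * r)"
  define C where "C = exp (- (\<mu>\<^sup>2 / 2) * (a + r)) / (2 * pi * sqrt a * (r * sqrt r))"
  have pos: "0 < k" "0 < C"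
    using assms by (auto simp: k_def C_def)
  have "- (- x - \<mu> * a)\<^sup>2 / (2 * a) + - (x - \<mu> * r)\<^sup>2 / (2 * r) = - (\<mu>\<^sup>2 / 2) * (a + r) + - k * x\<^sup>2" for x
    using assms by (simp add: k_def field_simps power2_eq_square)
  then have exps: "exp (- (- x - \<mu> * a)\<^sup>2 / (2 * a)) * exp (- (x - \<mu> * r)\<^sup>2 / (2 * r)) = exp (- (\<mu>\<^sup>2 / 2) * (a + r)) * exp (- k * x\<^sup>2)" for x
    by (metis exp_add)
  define w where "w = sqrt (2 * pi)"
  have ww: "2 * pi = w * w" "pi * 2 = w * w"
    by (simp_all add: w_def)
  have "sqrt (2 * pi * r ^ 3) = w * (r * sqrt r)" "sqrt (2 * pi * (sqrt a)\<^sup>2) = w * sqrt a"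
    using assms by (simp_all add: w_def real_sqrt_mult power3_eq_cube)
  then have "normal_density (\<mu> * a) (sqrt a) (- x) * passage_density \<mu> x r
     = (exp (- (- x - \<mu> * a)\<^sup>2 / (2 * a)) * exp (- (x - \<mu> * r)\<^sup>2 / (2 * r))) * (x / (2 * pi * sqrt a * (r * sqrt r)))" for x
    using assms by (simp add: normal_density_def passage_density_def ww mult_ac)
  then have "normal_density (\<mu> * a) (sqrt a) (- x) * passage_density \<mu> x r = C * (x * exp (- k * x\<^sup>2))" for x
    unfolding exps C_def by simp
  then have "(\<integral>\<^sup>+x\<in>{0<..}. ennreal (normal_density (\<mu> * a) (sqrt a) (- x) * passage_density \<mu> x r) \<partial>lborel)
     = (\<integral>\<^sup>+x. ennreal (C * (x * exp (- k * x\<^sup>2))) * indicator {0..} x \<partial>lborel)"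
    by (intro nn_integral_cong) (auto split: split_indicator)
  also have "\<dots> = ennreal (0 - (- C / (2 * k) * exp (- k * 0\<^sup>2)))"
  proof (rule nn_integral_FTC_atLeast)
    show "((\<lambda>x. - C / (2 * k) * exp (- k * x\<^sup>2)) has_real_derivative C * (x * exp (- k * x\<^sup>2))) (at x)" for x
      using pos by (auto intro!: derivative_eq_intros simp: field_simps)
    show "((\<lambda>x. - C / (2 * k) * exp (- k * x\<^sup>2)) \<longlongrightarrow> 0) at_top"
      using pos by real_asymp
  qed (use pos in auto)
  also have "0 - (- C / (2 * k) * exp (- k * 0\<^sup>2)) = 1 / (2 * pi * (a + r)) * sqrt (a / r) * exp (- (\<mu>\<^sup>2 / 2) * (a + r))"
  proof -
    let ?E = "exp (- (\<mu>\<^sup>2 / 2) * (a + r))"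
    have "0 - (- C / (2 * k) * exp (- k * 0\<^sup>2)) = a / sqrt a * (?E / (2 * pi * sqrt r * (a + r)))"
      using assms by (simp add: C_def k_def field_simps)
    also have "a / sqrt a = sqrt a"
      using assms by (simp add: real_div_sqrt)
    finally show ?thesis
      by (simp add: real_sqrt_divide)
  qed
  finally show ?thesis .
qed

text \<open>Here \<open>u\<close> is the position at time \<open>a\<close> and \<open>v\<close> the
  displacement during the remaining time \<open>s\<close>. With \<open>u = - x\<close> the inner
  integral becomes a passage probability; after exchanging the integrals \<open>x\<close> is
  integrated out for each fixed passage time \<open>r\<close>.\<close>

lemma nn_integral_sign_change:
  assumes "0 < a" "0 < s"
  shows "(\<integral>\<^sup>+u. \<integral>\<^sup>+v. ennreal (normal_density (\<mu> * a) (sqrt a) u) * ennreal (normal_density (\<mu> * s) (sqrt s) v)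
        * (indicator {..<0} u * indicator {0<..} (u + v) * ennreal (1 + exp (- 2 * \<mu> * (u + v)))) \<partial>lborel \<partial>lborel)
    = (\<integral>\<^sup>+r\<in>{0<..<s}. ennreal (1 / (2 * pi * (a + r)) * sqrt (a / r) * exp (- (\<mu>\<^sup>2 / 2) * (a + r))) \<partial>lborel)"
    (is "(\<integral>\<^sup>+u. ?I u \<partial>lborel) = _")
proof -
  have "(\<integral>\<^sup>+u. ?I u \<partial>lborel) = ennreal \<bar>- 1\<bar> * (\<integral>\<^sup>+x. ?I (0 + (- 1) * x) \<partial>lborel)"
    by (rule nn_integral_real_affine) auto
  also have "\<dots> = (\<integral>\<^sup>+x. ?I (- x) \<partial>lborel)"
    by simp
  also have "\<dots> = (\<integral>\<^sup>+x. \<integral>\<^sup>+r. ennreal (normal_density (\<mu> * a) (sqrt a) (- x) * passage_density \<mu> x r)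
      * indicator {0<..} x * indicator {0<..<s} r \<partial>lborel \<partial>lborel)"
  proof (rule nn_integral_cong)
    fix x :: real
    show "?I (- x) = (\<integral>\<^sup>+r. ennreal (normal_density (\<mu> * a) (sqrt a) (- x) * passage_density \<mu> x r)
      * indicator {0<..} x * indicator {0<..<s} r \<partial>lborel)"
    proof (cases "0 < x")
      case True
      have "?I (- x) = (\<integral>\<^sup>+v. ennreal (normal_density (\<mu> * a) (sqrt a) (- x)) *
          (ennreal (normal_density (\<mu> * s) (sqrt s) v * (1 + exp (- 2 * \<mu> * (v - x)))) * indicator {x<..} v) \<partial>lborel)"
        using True by (intro nn_integral_cong) (auto simp: ennreal_mult mult.assoc split: split_indicator)
      also have "\<dots> = ennreal (normal_density (\<mu> * a) (sqrt a) (- x)) *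
          (\<integral>\<^sup>+r\<in>{0<..<s}. ennreal (passage_density \<mu> x r) \<partial>lborel)"
        by (subst nn_integral_cmult, measurable, simp only: nn_integral_passage_density[OF True assms(2)])
      also have "\<dots> = (\<integral>\<^sup>+r. ennreal (normal_density (\<mu> * a) (sqrt a) (- x)) *
          (ennreal (passage_density \<mu> x r) * indicator {0<..<s} r) \<partial>lborel)"
        by (subst nn_integral_cmult) (auto simp: passage_density_def)
      also have "\<dots> = (\<integral>\<^sup>+r. ennreal (normal_density (\<mu> * a) (sqrt a) (- x) * passage_density \<mu> x r)
          * indicator {0<..} x * indicator {0<..<s} r \<partial>lborel)"
        using True by (intro nn_integral_cong) (auto simp: ennreal_mult' mult.assoc split: split_indicator)
      finally show ?thesis .
    qed simp
  qed
  also have "\<dots> = (\<integral>\<^sup>+r. \<integral>\<^sup>+x. ennreal (normal_density (\<mu> * a) (sqrt a) (- x) * passage_density \<mu> x r)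
      * indicator {0<..} x * indicator {0<..<s} r \<partial>lborel \<partial>lborel)"
    by (rule lborel_pair.Fubini'[symmetric])
      (auto simp: split_beta' passage_density_def normal_density_def)
  also have "\<dots> = (\<integral>\<^sup>+r\<in>{0<..<s}. ennreal (1 / (2 * pi * (a + r)) * sqrt (a / r) * exp (- (\<mu>\<^sup>2 / 2) * (a + r))) \<partial>lborel)"
    by (intro nn_integral_cong)
      (use assms in \<open>auto simp: nn_integral_normal_passage_density split: split_indicator\<close>)
  finally show ?thesis .
qed

section \<open>Integrals of the last zero density\<close>

text \<open>The arcsine law. The case \<open>a = 0\<close>, where the value is \<open>pi\<close>,
  later yields the total mass of the density.\<close>

lemma nn_integral_arcsine_density:
  assumes "0 \<le> a" "a < y"
  shows "(\<integral>\<^sup>+b\<in>{a<..<y}. ennreal (1 / sqrt (b * (y - b))) \<partial>lborel) = ennreal (2 * arccos (sqrt (a / y)))"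
proof -
  let ?F = "\<lambda>b. - 2 * arccos (sqrt (b / y))"
  have "(\<integral>\<^sup>+b\<in>{a<..<y}. ennreal (1 / sqrt (b * (y - b))) \<partial>lborel) = ennreal (?F y - ?F a)"
  proof (rule nn_integral_FTC_interior)
    show "continuous_on {a..y} ?F"
      using assms by (intro continuous_intros) (auto intro: order.trans[of _ 0])
    fix b assume b: "a < b" "b < y"
    then have "sqrt (b * (y - b)) = y * (sqrt (b / y) * sqrt (1 - b / y))"
    proof -
      have "b * (y - b) = y\<^sup>2 * (b / y * (1 - b / y))"
        using assms by (simp add: field_simps power2_eq_square)
      then have "sqrt (b * (y - b)) = sqrt (y\<^sup>2 * (b / y * (1 - b / y)))"
        by (simp only:)
      also have "\<dots> = y * (sqrt (b / y) * sqrt (1 - b / y))"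
        unfolding real_sqrt_mult using assms by simp
      finally show ?thesis .
    qed
    moreover have "- 1 < sqrt (b / y)" "sqrt (b / y) < 1" "0 < b / y" "b / y < 1"
      using b assms by (auto intro: less_le_trans[of _ 0])
    ultimately show "(?F has_real_derivative 1 / sqrt (b * (y - b))) (at b)"
      using b assms by (auto intro!: derivative_eq_intros simp: field_simps)
  qed (use assms in auto)
  then show ?thesis
    using assms by simp
qed

lemma nn_integral_last_zero_kernel:
  assumes "0 < a" "a < y"
  shows "(\<integral>\<^sup>+r\<in>{a<..<y}. ennreal (1 / r * sqrt (a / (r - a))) \<partial>lborel) = ennreal (2 * arccos (sqrt (a / y)))"
proof -
  let ?F = "\<lambda>r. 2 * arccos (sqrt (a / r))"
  have "(\<integral>\<^sup>+r\<in>{a<..<y}. ennreal (1 / r * sqrt (a / (r - a))) \<partial>lborel) = ennreal (?F y - ?F a)"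
  proof (rule nn_integral_FTC_interior)
    show "continuous_on {a..y} ?F"
      using assms by (intro continuous_intros) (auto intro: order.trans[of _ 0])
    fix r assume r: "a < r" "r < y"
    have "0 < sqrt a" "0 < sqrt r" "0 < sqrt (r - a)" and sq: "a = sqrt a * sqrt a" "r = sqrt r * sqrt r" "r - a = sqrt (r - a) * sqrt (r - a)"
      using r assms by auto
    have eq: "1 - a / r = (r - a) / r"
      using r assms by (simp add: field_simps)
    have "- 1 < sqrt (a / r)" "sqrt (a / r) < 1" "0 < a / r" "a / r < 1"
      using r assms by (auto intro: less_le_trans[of _ 0])
    then have "(?F has_real_derivative 2 * (inverse (- sqrt (1 - a / r)) * (inverse (sqrt (a / r)) / 2 * (- a / (r * r))))) (at r)"
      using r assms by (auto intro!: derivative_eq_intros simp: divide_less_0_iff)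
    also have "2 * (inverse (- sqrt (1 - a / r)) * (inverse (sqrt (a / r)) / 2 * (- a / (r * r)))) = 1 / r * sqrt (a / (r - a))"
      unfolding eq real_sqrt_divide using \<open>0 < sqrt a\<close> \<open>0 < sqrt r\<close> \<open>0 < sqrt (r - a)\<close> sq r assms
      by (simp add: field_simps)
    finally show "(?F has_real_derivative 1 / r * sqrt (a / (r - a))) (at r)" .
  qed (use assms in auto)
  then show ?thesis
    using assms by simp
qed

text \<open>Writes an exponential as its value at the end time plus an integral of its derivative.
  Inserted under another integral and followed by Tonelli's theorem, this does the work of an
  integration by parts and produces the two summands of the density.\<close>

lemma nn_integral_exp_tail:
  assumes "x < t"
  shows "ennreal (exp (- (\<mu>\<^sup>2 * t / 2))) + (\<integral>\<^sup>+y\<in>{x<..<t}. ennreal (\<mu>\<^sup>2 / 2 * exp (- (\<mu>\<^sup>2 * y / 2))) \<partial>lborel)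
    = ennreal (exp (- (\<mu>\<^sup>2 * x / 2)))"
proof -
  have "(\<integral>\<^sup>+y\<in>{x<..<t}. ennreal (\<mu>\<^sup>2 / 2 * exp (- (\<mu>\<^sup>2 * y / 2))) \<partial>lborel)
      = ennreal (- exp (- (\<mu>\<^sup>2 * t / 2)) - (- exp (- (\<mu>\<^sup>2 * x / 2))))"
    using assms by (intro nn_integral_FTC_interior)
      (auto intro!: continuous_intros derivative_eq_intros)
  moreover have "exp (- (\<mu>\<^sup>2 * t / 2)) \<le> exp (- (\<mu>\<^sup>2 * x / 2))"
    using assms by (auto intro: mult_left_mono)
  ultimately show ?thesis
    by (simp flip: ennreal_plus)
qed

text \<open>Exchanging the order on the triangle \<open>a < b < y < t\<close> makes the integral
  over \<open>b\<close> the inner one, where it is the arcsine integral with end point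
  \<open>y\<close>. The right-hand side is the meeting point with
  \<open>nn_integral_last_zero_tail\<close>.\<close>

lemma nn_integral_last_zero_density:
  assumes "0 \<le> a" "a < t"
  shows "(\<integral>\<^sup>+b\<in>{a<..<t}. (ennreal (exp (- (\<mu>\<^sup>2 * t / 2)) / (pi * sqrt (b * (t - b))))
        + (\<integral>\<^sup>+y\<in>{b<..<t}. ennreal (\<mu>\<^sup>2 / (2 * pi) * (exp (- (\<mu>\<^sup>2 * y / 2)) / sqrt (b * (y - b)))) \<partial>lborel)) \<partial>lborel)
    = ennreal (exp (- (\<mu>\<^sup>2 * t / 2)) / pi) * ennreal (2 * arccos (sqrt (a / t)))
      + (\<integral>\<^sup>+y\<in>{a<..<t}. ennreal (\<mu>\<^sup>2 / (2 * pi) * exp (- (\<mu>\<^sup>2 * y / 2))) * ennreal (2 * arccos (sqrt (a / y))) \<partial>lborel)"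
    (is "?L = ?R1 + ?R2")
proof -
  let ?E = "\<lambda>y. exp (- (\<mu>\<^sup>2 * y / 2))"
  let ?g = "\<lambda>b y. ennreal (\<mu>\<^sup>2 / (2 * pi) * (?E y / sqrt (b * (y - b))))"
  have [measurable]: "case_prod ?g \<in> borel_measurable (borel \<Otimes>\<^sub>M borel)"
    unfolding split_beta' by measurable
  have "?L = (\<integral>\<^sup>+b\<in>{a<..<t}. ennreal (?E t / (pi * sqrt (b * (t - b)))) \<partial>lborel)
     + (\<integral>\<^sup>+b\<in>{a<..<t}. (\<integral>\<^sup>+y\<in>{b<..<t}. ?g b y \<partial>lborel) \<partial>lborel)"
    unfolding distrib_right by (rule nn_integral_add) (simp_all add: indicator_def of_bool_def)
  also have "(\<integral>\<^sup>+b\<in>{a<..<t}. ennreal (?E t / (pi * sqrt (b * (t - b)))) \<partial>lborel)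
      = (\<integral>\<^sup>+b. ennreal (?E t / pi) * (ennreal (1 / sqrt (b * (t - b))) * indicator {a<..<t} b) \<partial>lborel)"
    by (intro nn_integral_cong) (use assms in \<open>auto simp flip: ennreal_mult split: split_indicator\<close>)
  also have "\<dots> = ?R1"
    by (subst nn_integral_cmult) (use assms in \<open>auto simp: nn_integral_arcsine_density\<close>)
  also have "(\<integral>\<^sup>+b\<in>{a<..<t}. (\<integral>\<^sup>+y\<in>{b<..<t}. ?g b y \<partial>lborel) \<partial>lborel)
      = (\<integral>\<^sup>+y\<in>{a<..<t}. (\<integral>\<^sup>+b\<in>{a<..<y}. ?g b y \<partial>lborel) \<partial>lborel)"
    by (rule nn_integral_triangle_swap) measurable
  also have "\<dots> = ?R2"
  proof (intro nn_integral_cong)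
    fix y :: real
    have "(\<integral>\<^sup>+b\<in>{a<..<y}. ?g b y \<partial>lborel) = ennreal (\<mu>\<^sup>2 / (2 * pi) * ?E y) * ennreal (2 * arccos (sqrt (a / y)))" if "a < y"
    proof -
      have "(\<integral>\<^sup>+b\<in>{a<..<y}. ?g b y \<partial>lborel)
        = (\<integral>\<^sup>+b. ennreal (\<mu>\<^sup>2 / (2 * pi) * ?E y) * (ennreal (1 / sqrt (b * (y - b))) * indicator {a<..<y} b) \<partial>lborel)"
        by (intro nn_integral_cong) (use assms in \<open>auto simp flip: ennreal_mult split: split_indicator\<close>)
      also have "\<dots> = ennreal (\<mu>\<^sup>2 / (2 * pi) * ?E y) * ennreal (2 * arccos (sqrt (a / y)))"
        by (subst nn_integral_cmult) (use assms that in \<open>auto simp: nn_integral_arcsine_density\<close>)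
      finally show ?thesis .
    qed
    then show "(\<integral>\<^sup>+b\<in>{a<..<y}. ?g b y \<partial>lborel) * indicator {a<..<t} y
      = ennreal (\<mu>\<^sup>2 / (2 * pi) * ?E y) * ennreal (2 * arccos (sqrt (a / y))) * indicator {a<..<t} y"
      by (auto split: split_indicator)
  qed
  finally show ?thesis .
qed

text \<open>The left-hand side is the tail probability after the shift \<open>r = a + s\<close>.
  Splitting \<open>exp (- (\<mu>\<^sup>2 * r / 2))\<close> by \<open>nn_integral_exp_tail\<close>
  leaves the bare kernel to be integrated, once up to \<open>t\<close> and once up to each
  \<open>y\<close>.\<close>

lemma nn_integral_last_zero_tail:
  assumes "0 < a" "a < t"
  shows "(\<integral>\<^sup>+r\<in>{a<..<t}. ennreal (1 / (pi * r) * sqrt (a / (r - a)) * exp (- (\<mu>\<^sup>2 * r / 2))) \<partial>lborel)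
    = ennreal (exp (- (\<mu>\<^sup>2 * t / 2)) / pi) * ennreal (2 * arccos (sqrt (a / t)))
      + (\<integral>\<^sup>+y\<in>{a<..<t}. ennreal (\<mu>\<^sup>2 / (2 * pi) * exp (- (\<mu>\<^sup>2 * y / 2))) * ennreal (2 * arccos (sqrt (a / y))) \<partial>lborel)"
    (is "?L = ?R1 + ?R2")
proof -
  let ?E = "\<lambda>y. exp (- (\<mu>\<^sup>2 * y / 2))" and ?k = "\<lambda>r. 1 / r * sqrt (a / (r - a))"
  let ?g = "\<lambda>r y. ennreal (?k r) * ennreal (\<mu>\<^sup>2 / (2 * pi) * ?E y)"
  have [measurable]: "case_prod ?g \<in> borel_measurable (borel \<Otimes>\<^sub>M borel)"
    unfolding split_beta' by measurable
  have "?L = (\<integral>\<^sup>+r\<in>{a<..<t}. (ennreal (?E t / pi) * ennreal (?k r) + (\<integral>\<^sup>+y\<in>{r<..<t}. ?g r y \<partial>lborel)) \<partial>lborel)"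
  proof (intro nn_integral_cong)
    fix r :: real
    have "ennreal (1 / (pi * r) * sqrt (a / (r - a)) * ?E r)
       = ennreal (?E t / pi) * ennreal (?k r) + (\<integral>\<^sup>+y\<in>{r<..<t}. ?g r y \<partial>lborel)" if "a < r" "r < t"
    proof -
      have "ennreal (1 / (pi * r) * sqrt (a / (r - a)) * ?E r) = ennreal (?k r / pi) * ennreal (?E r)"
        using that assms by (simp flip: ennreal_mult add: mult_ac)
      also have "\<dots> = ennreal (?k r / pi) * ennreal (?E t) + (\<integral>\<^sup>+y. ennreal (?k r / pi) * (ennreal (\<mu>\<^sup>2 / 2 * ?E y) * indicator {r<..<t} y) \<partial>lborel)"
        using that by (simp add: nn_integral_exp_tail[symmetric] distrib_left nn_integral_cmult)
      also have "(\<integral>\<^sup>+y. ennreal (?k r / pi) * (ennreal (\<mu>\<^sup>2 / 2 * ?E y) * indicator {r<..<t} y) \<partial>lborel)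
         = (\<integral>\<^sup>+y\<in>{r<..<t}. ?g r y \<partial>lborel)"
        using that assms by (intro nn_integral_cong) (auto simp flip: ennreal_mult split: split_indicator simp: mult_ac)
      also have "ennreal (?k r / pi) * ennreal (?E t) = ennreal (?E t / pi) * ennreal (?k r)"
        using that assms by (simp flip: ennreal_mult add: mult_ac)
      finally show ?thesis .
    qed
    then show "ennreal (1 / (pi * r) * sqrt (a / (r - a)) * ?E r) * indicator {a<..<t} r
      = (ennreal (?E t / pi) * ennreal (?k r) + (\<integral>\<^sup>+y\<in>{r<..<t}. ?g r y \<partial>lborel)) * indicator {a<..<t} r"
      by (auto split: split_indicator)
  qed
  also have "\<dots> = (\<integral>\<^sup>+r. ennreal (?E t / pi) * (ennreal (?k r) * indicator {a<..<t} r) \<partial>lborel)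
     + (\<integral>\<^sup>+r\<in>{a<..<t}. (\<integral>\<^sup>+y\<in>{r<..<t}. ?g r y \<partial>lborel) \<partial>lborel)"
    unfolding distrib_right mult.assoc by (rule nn_integral_add) (simp_all add: indicator_def of_bool_def)
  also have "(\<integral>\<^sup>+r. ennreal (?E t / pi) * (ennreal (?k r) * indicator {a<..<t} r) \<partial>lborel) = ?R1"
    by (subst nn_integral_cmult) (use assms in \<open>auto simp: nn_integral_last_zero_kernel[simplified]\<close>)
  also have "(\<integral>\<^sup>+r\<in>{a<..<t}. (\<integral>\<^sup>+y\<in>{r<..<t}. ?g r y \<partial>lborel) \<partial>lborel)
     = (\<integral>\<^sup>+y\<in>{a<..<t}. (\<integral>\<^sup>+r\<in>{a<..<y}. ?g r y \<partial>lborel) \<partial>lborel)"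
    by (rule nn_integral_triangle_swap) measurable
  also have "\<dots> = ?R2"
  proof (intro nn_integral_cong)
    fix y :: real
    have "(\<integral>\<^sup>+r\<in>{a<..<y}. ?g r y \<partial>lborel) = ennreal (\<mu>\<^sup>2 / (2 * pi) * ?E y) * ennreal (2 * arccos (sqrt (a / y)))" if "a < y"
    proof -
      have "(\<integral>\<^sup>+r\<in>{a<..<y}. ?g r y \<partial>lborel)
        = (\<integral>\<^sup>+r. ennreal (\<mu>\<^sup>2 / (2 * pi) * ?E y) * (ennreal (?k r) * indicator {a<..<y} r) \<partial>lborel)"
        by (intro nn_integral_cong) (simp add: mult_ac)
      also have "\<dots> = ennreal (\<mu>\<^sup>2 / (2 * pi) * ?E y) * ennreal (2 * arccos (sqrt (a / y)))"
        by (subst nn_integral_cmult) (use assms that in \<open>auto simp: nn_integral_last_zero_kernel[simplified]\<close>)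
      finally show ?thesis .
    qed
    then show "(\<integral>\<^sup>+r\<in>{a<..<y}. ?g r y \<partial>lborel) * indicator {a<..<t} y
      = ennreal (\<mu>\<^sup>2 / (2 * pi) * ?E y) * ennreal (2 * arccos (sqrt (a / y))) * indicator {a<..<t} y"
      by (auto split: split_indicator)
  qed
  finally show ?thesis .
qed

section \<open>Set integrals and changes of variables\<close>

lemma nn_integral_Icc_eq_Ioo:
  fixes f :: "real \<Rightarrow> ennreal"
  shows "(\<integral>\<^sup>+x\<in>{a..b}. f x \<partial>lborel) = (\<integral>\<^sup>+x\<in>{a<..<b}. f x \<partial>lborel)"
proof (rule nn_integral_cong_AE)
  show "AE x in lborel. f x * indicator {a..b} x = f x * indicator {a<..<b} x"
    using AE_lborel_singleton[of a] AE_lborel_singleton[of b]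
    by eventually_elim (auto split: split_indicator)
qed

text \<open>This holds even if the nonnegative integral is infinite, since both sides then take the
  default value 0.\<close>

lemma set_integral_eq_enn2real:
  fixes f :: "real \<Rightarrow> real"
  assumes [measurable]: "f \<in> borel_measurable borel" "A \<in> sets borel" and "\<And>x. x \<in> A \<Longrightarrow> 0 \<le> f x"
  shows "(LBINT x:A. f x) = enn2real (\<integral>\<^sup>+x\<in>A. ennreal (f x) \<partial>lborel)"
proof -
  have "(LBINT x:A. f x) = enn2real (\<integral>\<^sup>+x. ennreal (indicator A x *\<^sub>R f x) \<partial>lborel)"
    unfolding set_lebesgue_integral_def using assms(3)
    by (intro integral_eq_nn_integral) (auto simp: indicator_def)
  also have "(\<integral>\<^sup>+x. ennreal (indicator A x *\<^sub>R f x) \<partial>lborel) = (\<integral>\<^sup>+x\<in>A. ennreal (f x) \<partial>lborel)"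
    by (intro nn_integral_cong) (auto split: split_indicator)
  finally show ?thesis .
qed

text \<open>The identity \<open>eq\<close> concerns the interior only, because it can fail at an
  endpoint: in \<open>last_zero_integral_sqrt\<close> division by zero makes its left side 0 at
  \<open>y = 0\<close>, where \<open>h\<close> is positive.\<close>

lemma nn_set_integral_substitution:
  fixes f :: "real \<Rightarrow> real"
  assumes [measurable]: "f \<in> borel_measurable borel"
    and "\<And>x. x \<in> {a..b} \<Longrightarrow> (g has_real_derivative g' x) (at x)" "continuous_on {a..b} g'"
    and "\<And>x. x \<in> {a..b} \<Longrightarrow> 0 \<le> g' x" "a \<le> b"
    and eq: "\<And>x. a < x \<Longrightarrow> x < b \<Longrightarrow> f (g x) * g' x = h x"
  shows "(\<integral>\<^sup>+x\<in>{g a..g b}. ennreal (f x) \<partial>lborel) = (\<integral>\<^sup>+x\<in>{a..b}. ennreal (h x) \<partial>lborel)"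
proof -
  have "(\<integral>\<^sup>+x\<in>{g a..g b}. ennreal (f x) \<partial>lborel) = (\<integral>\<^sup>+x. ennreal (f x * indicator {g a..g b} x) \<partial>lborel)"
    by (intro nn_integral_cong) (auto split: split_indicator)
  also have "\<dots> = (\<integral>\<^sup>+x. ennreal (f (g x) * g' x * indicator {a..b} x) \<partial>lborel)"
    using assms by (intro nn_integral_substitution) (auto simp: set_borel_measurable_def)
  also have "\<dots> = (\<integral>\<^sup>+x\<in>{a..b}. ennreal (f (g x) * g' x) \<partial>lborel)"
    by (intro nn_integral_cong) (auto split: split_indicator)
  also have "\<dots> = (\<integral>\<^sup>+x\<in>{a..b}. ennreal (h x) \<partial>lborel)"
    unfolding nn_integral_Icc_eq_Ioo by (intro nn_integral_cong) (auto simp: eq split: split_indicator)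
  finally show ?thesis .
qed

text \<open>The substitution \<open>s = a * y\<^sup>2\<close>, whose derivative removes the
  singularity of \<open>sqrt (a / s)\<close> at 0.\<close>

lemma last_zero_integral_sqrt:
  assumes "0 < a" "a < t"
  shows "(LBINT s:{0..t - a}. 1 / (pi * (a + s)) * sqrt (a / s) * exp (- (\<mu>\<^sup>2 / 2) * (a + s)))
    = 2 / pi * (LBINT y:{0..sqrt ((t - a) / a)}. exp (- (\<mu>\<^sup>2 * a / 2) * (1 + y\<^sup>2)) / (1 + y\<^sup>2))"
proof -
  let ?f = "\<lambda>s. 1 / (pi * (a + s)) * sqrt (a / s) * exp (- (\<mu>\<^sup>2 / 2) * (a + s))"
  let ?h = "\<lambda>y. 2 / pi * (exp (- (\<mu>\<^sup>2 * a / 2) * (1 + y\<^sup>2)) / (1 + y\<^sup>2))"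
  have "(\<integral>\<^sup>+s\<in>{a * 0\<^sup>2..a * (sqrt ((t - a) / a))\<^sup>2}. ennreal (?f s) \<partial>lborel)
      = (\<integral>\<^sup>+y\<in>{0..sqrt ((t - a) / a)}. ennreal (?h y) \<partial>lborel)"
  proof (rule nn_set_integral_substitution)
    show "((\<lambda>y. a * y\<^sup>2) has_real_derivative 2 * a * y) (at y)" for y
      by (auto intro!: derivative_eq_intros)
    fix y :: real assume "0 < y"
    have eq: "a + a * y\<^sup>2 = a * (1 + y\<^sup>2)"
      by (simp add: algebra_simps)
    have root: "sqrt (a / (a * y\<^sup>2)) = 1 / y"
      using assms \<open>0 < y\<close> by (simp add: real_sqrt_divide)
    have arg: "- (\<mu>\<^sup>2 / 2) * (a * (1 + y\<^sup>2)) = - (\<mu>\<^sup>2 * a / 2) * (1 + y\<^sup>2)"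
      by simp
    have "1 / (pi * (a * w)) * (1 / y) * E * (2 * a * y) = 2 / pi * (E / w)" if "0 < w" for w E
      using assms \<open>0 < y\<close> that by (simp add: field_simps)
    moreover have "0 < 1 + y\<^sup>2"
      by (simp add: add_pos_nonneg)
    ultimately show "1 / (pi * (a + a * y\<^sup>2)) * sqrt (a / (a * y\<^sup>2)) * exp (- (\<mu>\<^sup>2 / 2) * (a + a * y\<^sup>2)) * (2 * a * y) = ?h y"
      unfolding eq root arg by blast
  qed (use assms in \<open>auto intro!: continuous_intros\<close>)
  also have "{a * 0\<^sup>2..a * (sqrt ((t - a) / a))\<^sup>2} = {0..t - a}"
    using assms by simp
  finally have "(LBINT s:{0..t - a}. ?f s) = (LBINT y:{0..sqrt ((t - a) / a)}. ?h y)"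
    using assms by (subst (1 2) set_integral_eq_enn2real) (auto intro!: divide_nonneg_nonneg)
  then show ?thesis by (simp only: set_integral_mult_right)
qed

text \<open>The substitution of \<open>tan \<theta>\<close> for \<open>y\<close>: its derivative
  \<open>1 + (tan \<theta>)\<^sup>2\<close> cancels the denominator, and the upper limits match
  because \<open>tan \<alpha>\<close> can be read off from
  \<open>cos \<alpha> = sqrt (a / t)\<close>.\<close>

lemma last_zero_integral_tan:
  assumes "0 < a" "a < t"
  shows "(LBINT y:{0..sqrt ((t - a) / a)}. exp (- (\<mu>\<^sup>2 * a / 2) * (1 + y\<^sup>2)) / (1 + y\<^sup>2))
    = exp (- (\<mu>\<^sup>2 * a / 2)) * (LBINT \<theta>:{0..arccos (sqrt (a / t))}. exp (- (\<mu>\<^sup>2 * a / 2) * (tan \<theta>)\<^sup>2))"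
proof -
  let ?f = "\<lambda>y. exp (- (\<mu>\<^sup>2 * a / 2) * (1 + y\<^sup>2)) / (1 + y\<^sup>2)"
  let ?h = "\<lambda>\<theta>. exp (- (\<mu>\<^sup>2 * a / 2)) * exp (- (\<mu>\<^sup>2 * a / 2) * (tan \<theta>)\<^sup>2)"
  define \<alpha> where "\<alpha> = arccos (sqrt (a / t))"
  have ratio: "0 < sqrt (a / t)" "sqrt (a / t) < 1"
    using assms by auto
  then have "- 1 \<le> sqrt (a / t)" "sqrt (a / t) \<le> 1"
    by linarith+
  then have \<alpha>: "0 \<le> \<alpha>" "cos \<alpha> = sqrt (a / t)"
    unfolding \<alpha>_def by (rule arccos_lbound, rule cos_arccos)
  have "\<alpha> < pi / 2"
    using arccos_less_arccos[of 0 "sqrt (a / t)"] ratio unfolding \<alpha>_def by auto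
  have cos_pos: "0 < cos \<theta>" if "\<theta> \<in> {0..\<alpha>}" for \<theta>
    using that \<open>\<alpha> < pi / 2\<close> by (intro cos_gt_zero_pi) auto
  have "0 \<le> sin \<alpha>"
    using \<alpha> \<open>\<alpha> < pi / 2\<close> by (intro sin_ge_zero) auto
  then have "sin \<alpha> = sqrt (1 - (sqrt (a / t))\<^sup>2)"
    using sin_cos_squared_add[of \<alpha>] \<alpha>(2) by (metis add_diff_cancel_right' real_sqrt_unique)
  also have "(sqrt (a / t))\<^sup>2 = a / t"
    using assms by simp
  finally have "tan \<alpha> = sqrt ((1 - a / t) / (a / t))"
    by (simp only: tan_def \<alpha>(2) real_sqrt_divide[of "1 - a / t"])
  also have "(1 - a / t) / (a / t) = (t - a) / a"
    using assms by (simp add: field_simps)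
  finally have tan_\<alpha>: "tan \<alpha> = sqrt ((t - a) / a)" .
  have "(\<integral>\<^sup>+y\<in>{tan 0..tan \<alpha>}. ennreal (?f y) \<partial>lborel) = (\<integral>\<^sup>+\<theta>\<in>{0..\<alpha>}. ennreal (?h \<theta>) \<partial>lborel)"
  proof (rule nn_set_integral_substitution)
    show "(tan has_real_derivative inverse ((cos \<theta>)\<^sup>2)) (at \<theta>)" if "\<theta> \<in> {0..\<alpha>}" for \<theta>
      using cos_pos[OF that] by (intro DERIV_tan) simp
    show "continuous_on {0..\<alpha>} (\<lambda>\<theta>. inverse ((cos \<theta>)\<^sup>2))"
      using cos_pos by (intro continuous_intros) force
    fix \<theta> assume "0 < \<theta>" "\<theta> < \<alpha>"
    then have c: "0 < cos \<theta>"
      by (intro cos_pos) auto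
    then have "inverse ((cos \<theta>)\<^sup>2) = 1 + (tan \<theta>)\<^sup>2"
      using tan_sec[of \<theta>] by (simp add: power_inverse)
    moreover have "1 + (tan \<theta>)\<^sup>2 \<noteq> 0"
      by (metis add_pos_nonneg less_irrefl zero_le_power2 zero_less_one)
    moreover have arg: "- (\<mu>\<^sup>2 * a / 2) * (1 + (tan \<theta>)\<^sup>2) = - (\<mu>\<^sup>2 * a / 2) + - (\<mu>\<^sup>2 * a / 2) * (tan \<theta>)\<^sup>2"
      by (simp only: distrib_left mult_1_right)
    ultimately show "exp (- (\<mu>\<^sup>2 * a / 2) * (1 + (tan \<theta>)\<^sup>2)) / (1 + (tan \<theta>)\<^sup>2) * inverse ((cos \<theta>)\<^sup>2) = ?h \<theta>"
      unfolding arg exp_add by simp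
  qed (use \<alpha> in auto)
  then have "(LBINT y:{0..sqrt ((t - a) / a)}. ?f y) = (LBINT \<theta>:{0..\<alpha>}. ?h \<theta>)"
    unfolding tan_\<alpha> tan_zero
    by (subst (1 2) set_integral_eq_enn2real) (auto simp: tan_def intro!: divide_nonneg_nonneg)
  then show ?thesis
    unfolding \<alpha>_def by simp
qed

text \<open>Substituting \<open>b * (1 + y\<^sup>2)\<close> turns a singular integrand into a
  continuous one on a compact interval. This gives finiteness as well as the value.\<close>

lemma nn_integral_last_zero_density_tail:
  assumes "0 < b" "b < t"
  shows "(\<integral>\<^sup>+y\<in>{b<..<t}. ennreal (exp (- (\<mu>\<^sup>2 * y / 2)) / sqrt (b * (y - b))) \<partial>lborel)
    = ennreal (2 * (LBINT y:{0..sqrt ((t - b) / b)}. exp (- (\<mu>\<^sup>2 * b / 2) * (1 + y\<^sup>2))))"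
proof -
  let ?f = "\<lambda>y. exp (- (\<mu>\<^sup>2 * y / 2)) / sqrt (b * (y - b))"
  let ?h = "\<lambda>y. exp (- (\<mu>\<^sup>2 * b / 2) * (1 + y\<^sup>2))"
  have "(\<integral>\<^sup>+y\<in>{b * (1 + 0\<^sup>2)..b * (1 + (sqrt ((t - b) / b))\<^sup>2)}. ennreal (?f y) \<partial>lborel)
      = (\<integral>\<^sup>+y\<in>{0..sqrt ((t - b) / b)}. ennreal (2 * ?h y) \<partial>lborel)"
  proof (rule nn_set_integral_substitution)
    show "((\<lambda>y. b * (1 + y\<^sup>2)) has_real_derivative 2 * b * y) (at y)" for y
      by (auto intro!: derivative_eq_intros)
    fix y :: real assume "0 < y"
    have "b * (b * (1 + y\<^sup>2) - b) = (b * y)\<^sup>2"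
      by (simp add: power2_eq_square algebra_simps)
    then have "sqrt (b * (b * (1 + y\<^sup>2) - b)) = b * y"
      using assms \<open>0 < y\<close> by simp
    then show "exp (- (\<mu>\<^sup>2 * (b * (1 + y\<^sup>2)) / 2)) / sqrt (b * (b * (1 + y\<^sup>2) - b)) * (2 * b * y) = 2 * ?h y"
      using assms \<open>0 < y\<close> by (simp add: mult.assoc)
  qed (use assms in \<open>auto intro!: continuous_intros\<close>)
  also have "{b * (1 + 0\<^sup>2)..b * (1 + (sqrt ((t - b) / b))\<^sup>2)} = {b..t}"
    using assms by (simp add: field_simps)
  also have "(\<integral>\<^sup>+y\<in>{0..sqrt ((t - b) / b)}. ennreal (2 * ?h y) \<partial>lborel)
     = (\<integral>\<^sup>+y. ennreal (indicator {0..sqrt ((t - b) / b)} y *\<^sub>R (2 * ?h y)) \<partial>lborel)"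
    by (intro nn_integral_cong) (auto split: split_indicator)
  also have "\<dots> = ennreal (LBINT y:{0..sqrt ((t - b) / b)}. 2 * ?h y)"
    unfolding set_lebesgue_integral_def
  proof (rule nn_integral_eq_integral)
    have "set_integrable lborel {0..sqrt ((t - b) / b)} (\<lambda>y. 2 * ?h y)"
      by (intro borel_integrable_atLeastAtMost' continuous_intros)
    then show "integrable lborel (\<lambda>y. indicator {0..sqrt ((t - b) / b)} y *\<^sub>R (2 * ?h y))"
      by (simp add: set_integrable_def)
  qed (auto simp: indicator_def)
  finally show ?thesis
    unfolding nn_integral_Icc_eq_Ioo by simp
qed

lemma last_zero_density_forms:
  assumes "0 < b" "b < t"
  shows "\<mu>\<^sup>2 / pi * (LBINT y:{0..sqrt ((t - b) / b)}. exp (- (\<mu>\<^sup>2 * b / 2) * (1 + y\<^sup>2)))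
    = \<mu>\<^sup>2 / (2 * pi) * (LBINT y:{b..t}. exp (- (\<mu>\<^sup>2 * y / 2)) / sqrt (b * (y - b)))"
proof -
  let ?J = "LBINT y:{0..sqrt ((t - b) / b)}. exp (- (\<mu>\<^sup>2 * b / 2) * (1 + y\<^sup>2))"
  have "0 \<le> ?J"
    unfolding set_lebesgue_integral_def by (intro integral_nonneg_AE) auto
  then have "(LBINT y:{b..t}. exp (- (\<mu>\<^sup>2 * y / 2)) / sqrt (b * (y - b))) = 2 * ?J"
    using assms
    by (subst set_integral_eq_enn2real)
      (auto simp: nn_integral_Icc_eq_Ioo nn_integral_last_zero_density_tail[simplified])
  then show ?thesis by simp
qed

section \<open>Brownian motion with drift\<close>

text \<open>A discrete stopping time, encoded as one event for each index rather than as a random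
  index. The event for \<open>k\<close> depends on \<open>y 0\<close> to \<open>y k\<close> only,
  which is what independence of increments can use.\<close>

definition first_crossing :: "real \<Rightarrow> (nat \<Rightarrow> real) \<Rightarrow> nat \<Rightarrow> bool" where
  "first_crossing c y k \<longleftrightarrow> (\<forall>j<k. y j < c) \<and> c \<le> y k"

text \<open>The drift is a locale parameter so that the class is closed under passing from
  \<open>X\<close>, \<open>\<mu>\<close> to \<open>- X\<close>, \<open>- \<mu>\<close>. Interpreting
  the locale for \<open>- X\<close> transfers every result on paths below a level at time
  \<open>a\<close> to paths above it.\<close>

locale drifted_brownian_motion = prob_space M for M :: "'a measure" +
  fixes X :: "real \<Rightarrow> 'a \<Rightarrow> real" and \<mu> :: real
  assumes random_variable_X: "\<And>s. 0 \<le> s \<Longrightarrow> random_variable borel (X s)"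
    and start_at_0: "\<And>\<omega>. \<omega> \<in> space M \<Longrightarrow> X 0 \<omega> = 0"
    and continuous_paths: "\<And>\<omega>. \<omega> \<in> space M \<Longrightarrow> continuous_on {0..} (\<lambda>s. X s \<omega>)"
    and normal_increments: "\<And>r s. 0 \<le> r \<Longrightarrow> r < s \<Longrightarrow>
      distributed M lborel (\<lambda>\<omega>. X s \<omega> - X r \<omega>)
        (\<lambda>x. ennreal (normal_density (\<mu> * (s - r)) (sqrt (s - r)) x))"
    and independent_increments: "\<And>(\<tau> :: nat \<Rightarrow> real) n.
      0 \<le> \<tau> 0 \<Longrightarrow> (\<forall>i<n. \<tau> i < \<tau> (Suc i)) \<Longrightarrow>
      indep_vars (\<lambda>_. borel) (\<lambda>i \<omega>. X (\<tau> (Suc i)) \<omega> - X (\<tau> i) \<omega>) {..<n}"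
begin

lemma drifted_brownian_motion_uminus: "drifted_brownian_motion M (\<lambda>s \<omega>. - X s \<omega>) (- \<mu>)"
proof
  show "distributed M lborel (\<lambda>\<omega>. - X s \<omega> - - X r \<omega>)
      (\<lambda>x. ennreal (normal_density (- \<mu> * (s - r)) (sqrt (s - r)) x))" if "0 \<le> r" "r < s" for r s
    using normal_density_affine[OF normal_increments[OF that], of "-1" 0] that by simp
  show "indep_vars (\<lambda>_. borel) (\<lambda>i \<omega>. - X (\<tau> (Suc i)) \<omega> - - X (\<tau> i) \<omega>) {..<n}"
    if "0 \<le> \<tau> 0" "\<forall>i<n. \<tau> i < \<tau> (Suc i)" for \<tau> :: "nat \<Rightarrow> real" and n
    using indep_vars_compose2[OF independent_increments[OF that], of "\<lambda>_ x. - x" "\<lambda>_. borel"] by simp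
qed (auto simp: start_at_0 intro: random_variable_X continuous_on_minus continuous_paths)

end

lemma (in standard_brownian_motion) drifted_brownian_motion:
  "drifted_brownian_motion M (\<lambda>s \<omega>. B s \<omega> + \<mu> * s) \<mu>"
proof
  show "distributed M lborel (\<lambda>\<omega>. B s \<omega> + \<mu> * s - (B r \<omega> + \<mu> * r))
      (\<lambda>x. ennreal (normal_density (\<mu> * (s - r)) (sqrt (s - r)) x))" if "0 \<le> r" "r < s" for r s
    using normal_density_affine[OF normal_increments[OF that], of 1 "\<mu> * (s - r)"] that
    by (simp add: algebra_simps)
  show "indep_vars (\<lambda>_. borel) (\<lambda>i \<omega>. B (\<tau> (Suc i)) \<omega> + \<mu> * \<tau> (Suc i) - (B (\<tau> i) \<omega> + \<mu> * \<tau> i)) {..<n}"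
    if "0 \<le> \<tau> 0" "\<forall>i<n. \<tau> i < \<tau> (Suc i)" for \<tau> :: "nat \<Rightarrow> real" and n
    using indep_vars_compose2[OF independent_increments[OF that],
        of "\<lambda>i x. x + \<mu> * (\<tau> (Suc i) - \<tau> i)" "\<lambda>_. borel"]
    by (simp add: algebra_simps)
qed (simp_all add: start_at_0 borel_measurable_add random_variable_B continuous_paths continuous_on_add continuous_on_mult_left)

context drifted_brownian_motion
begin

lemma distributed_X: "0 < s \<Longrightarrow> distributed M lborel (X s) (\<lambda>x. ennreal (normal_density (\<mu> * s) (sqrt s) x))"
  using normal_increments[of 0 s] start_at_0
  by (simp add: distributed_def cong: distr_cong measurable_cong)

lemma AE_X_neq:
  assumes "0 < s"
  shows "AE \<omega> in M. X s \<omega> \<noteq> c"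
  unfolding distributed_AE2[OF distributed_X[OF assms], of "\<lambda>x. x \<noteq> c", simplified]
  using AE_lborel_singleton[of c] by (auto elim: eventually_mono)

text \<open>Mean and variance are both proportional to \<open>s\<close>, so \<open>s\<close> cancels
  in the cross term of the exponent, which is \<open>\<mu> * x\<close>. Removing it twice reverses
  the drift.\<close>

lemma normal_density_exp_flip:
  assumes "0 < s"
  shows "normal_density (\<mu> * s) (sqrt s) x * exp (- 2 * \<mu> * x) = normal_density (\<mu> * s) (sqrt s) (- x)"
    and "normal_density (\<mu> * s) (sqrt s) x * exp (- 2 * \<mu> * x) = normal_density (- \<mu> * s) (sqrt s) x"
proof -
  have "- (x - \<mu> * s)\<^sup>2 / (2 * s) + (- 2 * \<mu> * x) = - (- x - \<mu> * s)\<^sup>2 / (2 * s)"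
    using assms by (simp add: field_simps power2_eq_square)
  then show *: "normal_density (\<mu> * s) (sqrt s) x * exp (- 2 * \<mu> * x) = normal_density (\<mu> * s) (sqrt s) (- x)"
    using assms by (simp add: normal_density_def flip: exp_add)
  show "normal_density (\<mu> * s) (sqrt s) x * exp (- 2 * \<mu> * x) = normal_density (- \<mu> * s) (sqrt s) x"
    unfolding * by (simp add: normal_density_def power2_eq_square algebra_simps)
qed

text \<open>Since \<open>s\<close> does not occur in the weight, the identity survives conditioning on a random starting time.\<close>

lemma expectation_flip:
  assumes "0 < s" and Z: "distributed M lborel Z (\<lambda>x. ennreal (normal_density (\<mu> * s) (sqrt s) x))"
    and [measurable]: "f \<in> borel_measurable borel"
  shows "expectation (\<lambda>\<omega>. f (Z \<omega>)) = expectation (\<lambda>\<omega>. f (- Z \<omega>) * exp (- 2 * \<mu> * Z \<omega>))"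
proof -
  have "expectation (\<lambda>\<omega>. f (- Z \<omega>) * exp (- 2 * \<mu> * Z \<omega>))
      = (\<integral>x. normal_density (\<mu> * s) (sqrt s) x * (f (- x) * exp (- 2 * \<mu> * x)) \<partial>lborel)"
    by (rule distributed_integral[symmetric, OF Z]) auto
  also have "\<dots> = (\<integral>x. normal_density (\<mu> * s) (sqrt s) (- x) * f (- x) \<partial>lborel)"
    by (simp add: normal_density_exp_flip(1)[OF assms(1), symmetric] mult_ac)
  also have "\<dots> = (\<integral>x. normal_density (\<mu> * s) (sqrt s) x * f x \<partial>lborel)"
    using lborel_integral_real_affine[of "- 1" "\<lambda>x. normal_density (\<mu> * s) (sqrt s) x * f x" 0] by simp
  also have "\<dots> = expectation (\<lambda>\<omega>. f (Z \<omega>))"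
    by (rule distributed_integral[OF Z]) auto
  finally show ?thesis ..
qed

text \<open>The weighted density is again a normal density, with drift \<open>- \<mu>\<close>. This
  supplies the majorants for dominated convergence.\<close>

lemma integrable_exp_X:
  assumes "0 < s"
  shows "integrable M (\<lambda>\<omega>. exp (- 2 * \<mu> * X s \<omega>))"
  by (subst distributed_integrable[OF distributed_X[OF assms], symmetric])
    (use assms in \<open>auto simp: normal_density_exp_flip(2)[OF assms, simplified]\<close>)

text \<open>Stated for arbitrary \<open>S\<close>, as it serves both for partial sums on a product
  space and for the process itself.\<close>

lemma pred_first_crossing:
  fixes S :: "nat \<Rightarrow> 'b \<Rightarrow> real"
  assumes [measurable]: "\<And>j. j \<le> k \<Longrightarrow> S j \<in> borel_measurable N"
  shows "Measurable.pred N (\<lambda>v. (\<forall>j<k. S j v < c) \<and> c \<le> S k v)"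
proof -
  have "{v \<in> space N. (\<forall>j\<in>{..<k}. S j v < c) \<and> c \<le> S k v} \<in> sets N"
    by (intro sets.sets_Collect_conj sets.sets_Collect_finite_All borel_measurable_less borel_measurable_le)
      (auto intro: assms)
  then show ?thesis by (simp add: pred_def Ball_def)
qed

text \<open>Whether the first crossing occurs at index \<open>k\<close> is decided by the increments
  up to \<open>\<tau> k\<close>, and these are independent of the displacement from
  \<open>\<tau> k\<close> to \<open>\<tau> n\<close>.\<close>

lemma expectation_first_crossing:
  fixes h :: "real \<Rightarrow> real"
  assumes "0 < \<tau> 0" and mono: "\<And>i j. i < j \<Longrightarrow> j \<le> n \<Longrightarrow> \<tau> i < \<tau> j" and "k < n"
    and [measurable]: "h \<in> borel_measurable borel" and bound: "\<And>z. \<bar>h z\<bar> \<le> K"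
  shows "expectation (\<lambda>\<omega>. of_bool (first_crossing c (\<lambda>j. X (\<tau> j) \<omega>) k) * h (X (\<tau> n) \<omega> - X (\<tau> k) \<omega>))
    = expectation (\<lambda>\<omega>. of_bool (first_crossing c (\<lambda>j. X (\<tau> j) \<omega>) k)) * expectation (\<lambda>\<omega>. h (X (\<tau> n) \<omega> - X (\<tau> k) \<omega>))"
proof -
  \<comment> \<open>The times 0, \<open>\<tau> 0\<close>, ..., \<open>\<tau> k\<close>,
    \<open>\<tau> n\<close>. Starting at 0 makes each \<open>X (\<tau> j)\<close> a partial sum of
    increments; jumping from \<open>\<tau> k\<close> to \<open>\<tau> n\<close> makes the later
    displacement the single increment \<open>D (Suc k)\<close>.\<close>
  define \<sigma> where "\<sigma> i = (case i of 0 \<Rightarrow> 0 | Suc j \<Rightarrow> if j \<le> k then \<tau> j else \<tau> n)" for i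
  define D where "D i \<omega> = X (\<sigma> (Suc i)) \<omega> - X (\<sigma> i) \<omega>" for i \<omega>
  have ind: "indep_vars (\<lambda>_. borel) D {..<k + 2}"
    unfolding D_def using assms(1) mono \<open>k < n\<close>
    by (intro independent_increments) (auto simp: \<sigma>_def split: nat.split)
  have sum_D: "(\<Sum>i<Suc j. D i \<omega>) = X (\<tau> j) \<omega>" if "j \<le> k" "\<omega> \<in> space M" for j \<omega>
    unfolding D_def using that by (subst sum_lessThan_telescope) (simp add: \<sigma>_def start_at_0)
  have last_D: "D (Suc k) \<omega> = X (\<tau> n) \<omega> - X (\<tau> k) \<omega>" for \<omega>
    by (simp add: D_def \<sigma>_def)
  define Y where "Y v = (of_bool ((\<forall>j<k. (\<Sum>i<Suc j. v i) < c) \<and> c \<le> (\<Sum>i<Suc k. v i)) :: real)" for v :: "nat \<Rightarrow> real"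
  have [measurable]: "Measurable.pred (PiM {..k} (\<lambda>_. borel)) (\<lambda>v. (\<forall>j<k. (\<Sum>i<Suc j. v i) < c) \<and> c \<le> (\<Sum>i<Suc k. v i))"
    by (intro pred_first_crossing borel_measurable_sum measurable_component_singleton) auto
  have Y: "Y \<in> borel_measurable (PiM {..k} (\<lambda>_. borel))"
    unfolding Y_def by measurable
  have h: "(\<lambda>v. h (v (Suc k))) \<in> borel_measurable (PiM {Suc k} (\<lambda>_. borel))"
    by measurable
  have *: "indep_var borel (Y \<circ> (\<lambda>\<omega>. restrict (\<lambda>i. D i \<omega>) {..k})) borel ((\<lambda>v. h (v (Suc k))) \<circ> (\<lambda>\<omega>. restrict (\<lambda>i. D i \<omega>) {Suc k}))"
    by (rule indep_var_compose[OF indep_var_restrict[OF ind] Y h]) auto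
  have Y_eq: "Y (restrict (\<lambda>i. D i \<omega>) {..k}) = of_bool (first_crossing c (\<lambda>j. X (\<tau> j) \<omega>) k)" if "\<omega> \<in> space M" for \<omega>
  proof -
    have "(\<Sum>i<Suc j. restrict (\<lambda>i. D i \<omega>) {..k} i) = X (\<tau> j) \<omega>" if "j \<le> k" for j
    proof -
      have "(\<Sum>i<Suc j. restrict (\<lambda>i. D i \<omega>) {..k} i) = (\<Sum>i<Suc j. D i \<omega>)"
        using that by (intro sum.cong) auto
      with sum_D[OF that \<open>\<omega> \<in> space M\<close>] show ?thesis by (simp only:)
    qed
    then show ?thesis by (simp add: Y_def first_crossing_def del: sum.lessThan_Suc)
  qed
  have "\<bar>Y v\<bar> \<le> 1" for v
    unfolding Y_def of_bool_def by (simp del: sum.lessThan_Suc)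
  then have int1: "integrable M (Y \<circ> (\<lambda>\<omega>. restrict (\<lambda>i. D i \<omega>) {..k}))"
    by (intro integrable_const_bound[OF _ indep_var_rv1[OF *], of 1]) simp
  have int2: "integrable M ((\<lambda>v. h (v (Suc k))) \<circ> (\<lambda>\<omega>. restrict (\<lambda>i. D i \<omega>) {Suc k}))"
    by (intro integrable_const_bound[OF _ indep_var_rv2[OF *], of K]) (simp add: bound)
  show ?thesis
    using indep_var_lebesgue_integral[OF * int1 int2]
    by (simp add: last_D Y_eq cong: Bochner_Integration.integral_cong)
qed

lemma first_crossing_measurable:
  assumes "\<And>j. j \<le> k \<Longrightarrow> 0 \<le> \<tau> j"
  shows "Measurable.pred M (\<lambda>\<omega>. first_crossing c (\<lambda>j. X (\<tau> j) \<omega>) k)"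
  unfolding first_crossing_def
  by (intro pred_first_crossing random_variable_X assms)

text \<open>Independence isolates the displacement, to which \<open>expectation_flip\<close>
  applies. The two bounds make both functions of the displacement integrable.\<close>

lemma first_crossing_reflect:
  fixes h :: "real \<Rightarrow> real"
  assumes "0 < \<tau> 0" and mono: "\<And>i j. i < j \<Longrightarrow> j \<le> n \<Longrightarrow> \<tau> i < \<tau> j" and "k \<le> n"
    and [measurable]: "h \<in> borel_measurable borel" and bound: "\<And>z. \<bar>h z\<bar> \<le> K"
    and bound': "\<And>z. \<bar>h (- z) * exp (- 2 * \<mu> * z)\<bar> \<le> K"
  shows "expectation (\<lambda>\<omega>. of_bool (first_crossing c (\<lambda>j. X (\<tau> j) \<omega>) k) * h (X (\<tau> n) \<omega> - X (\<tau> k) \<omega>))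
    = expectation (\<lambda>\<omega>. of_bool (first_crossing c (\<lambda>j. X (\<tau> j) \<omega>) k)
        * (h (- (X (\<tau> n) \<omega> - X (\<tau> k) \<omega>)) * exp (- 2 * \<mu> * (X (\<tau> n) \<omega> - X (\<tau> k) \<omega>))))"
\<comment> \<open>For \<open>k = n\<close> the displacement is 0 and both integrands carry the
  factor \<open>h 0\<close>; otherwise it has a nondegenerate normal law.\<close>
proof (cases "k = n")
  case False
  with \<open>k \<le> n\<close> have "k < n" by simp
  have "0 < \<tau> k"
    using assms(1) mono[of 0 k] \<open>k \<le> n\<close> by (cases k) auto
  let ?h' = "\<lambda>z. h (- z) * exp (- 2 * \<mu> * z)"
  have "expectation (\<lambda>\<omega>. h (X (\<tau> n) \<omega> - X (\<tau> k) \<omega>)) = expectation (\<lambda>\<omega>. ?h' (X (\<tau> n) \<omega> - X (\<tau> k) \<omega>))"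
    using \<open>0 < \<tau> k\<close> mono[OF \<open>k < n\<close>] by (intro expectation_flip[OF _ normal_increments]) auto
  moreover have "?h' \<in> borel_measurable borel"
    by measurable
  ultimately show ?thesis
    using expectation_first_crossing[where \<tau> = \<tau> and n = n and k = k and h = h and K = K and c = c]
      expectation_first_crossing[where \<tau> = \<tau> and n = n and k = k and h = ?h' and K = K and c = c]
      assms \<open>k < n\<close> by simp
qed simp

end

section \<open>First crossings on dyadic grids\<close>

text \<open>Halving the mesh keeps the old points. A level reached on one grid therefore stays
  reached on every finer one.\<close>

definition dyadic_grid :: "real \<Rightarrow> real \<Rightarrow> nat \<Rightarrow> nat \<Rightarrow> real" where
  "dyadic_grid a t n k = a + (t - a) * real k / 2 ^ n"

lemma dyadic_grid_simps [simp]: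
  "dyadic_grid a t n 0 = a" "dyadic_grid a t n (2 ^ n) = t"
  by (simp_all add: dyadic_grid_def)

lemma dyadic_grid_less_iff: "a < t \<Longrightarrow> dyadic_grid a t n i < dyadic_grid a t n j \<longleftrightarrow> i < j"
  by (simp add: dyadic_grid_def divide_less_cancel)

lemma dyadic_grid_mem: "a \<le> t \<Longrightarrow> k \<le> 2 ^ n \<Longrightarrow> dyadic_grid a t n k \<in> {a..t}"
proof -
  assume "a \<le> t" "k \<le> 2 ^ n"
  then have "(t - a) * real k \<le> (t - a) * 2 ^ n"
    using of_nat_mono[of k "2 ^ n", where 'a = real] by (intro mult_left_mono) auto
  then have "(t - a) * real k / 2 ^ n \<le> t - a"
    by (simp add: pos_divide_le_eq)
  then show ?thesis
    using \<open>a \<le> t\<close> by (simp add: dyadic_grid_def)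
qed

lemma dyadic_grid_ge: "a \<le> t \<Longrightarrow> a \<le> dyadic_grid a t n k"
  by (simp add: dyadic_grid_def)

lemma dyadic_grid_refine: "n \<le> m \<Longrightarrow> dyadic_grid a t m (k * 2 ^ (m - n)) = dyadic_grid a t n k"
  by (auto simp: dyadic_grid_def power_add le_iff_add)

lemma dyadic_grid_dense:
  assumes "a < t" "s \<in> {a..t}" "0 < e"
  shows "\<exists>n k. k \<le> 2 ^ n \<and> \<bar>dyadic_grid a t n k - s\<bar> < e"
proof -
  obtain n where n: "(t - a) / e < 2 ^ n"
    using real_arch_pow[of 2 "(t - a) / e"] by auto
  \<comment> \<open>The index of the last grid point that does not exceed \<open>s\<close>; the
    error is below the mesh, which \<open>n\<close> makes smaller than \<open>e\<close>.\<close>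
  define k where "k = nat \<lfloor>(s - a) / (t - a) * 2 ^ n\<rfloor>"
  have nonneg: "0 \<le> (s - a) / (t - a) * 2 ^ n"
    using assms by simp
  then have k: "real k \<le> (s - a) / (t - a) * 2 ^ n" "(s - a) / (t - a) * 2 ^ n < real k + 1"
    unfolding k_def by linarith+
  have "(s - a) / (t - a) * 2 ^ n \<le> 1 * 2 ^ n"
    using assms by (intro mult_right_mono) auto
  with k have "real k \<le> 2 ^ n" by linarith
  then have "k \<le> 2 ^ n"
    by (metis of_nat_le_iff of_nat_numeral of_nat_power)
  moreover have "\<bar>dyadic_grid a t n k - s\<bar> < e"
  proof -
    have eq: "s - dyadic_grid a t n k = ((s - a) / (t - a) * 2 ^ n - real k) * ((t - a) / 2 ^ n)"
      using assms by (simp add: dyadic_grid_def field_simps)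
    have "s - dyadic_grid a t n k \<le> 1 * ((t - a) / 2 ^ n)"
      unfolding eq using k assms by (intro mult_right_mono) auto
    moreover have "(t - a) / 2 ^ n < e"
      using assms n by (auto simp: field_simps)
    moreover have "0 \<le> s - dyadic_grid a t n k"
      unfolding eq using k assms by (intro mult_nonneg_nonneg) auto
    ultimately show ?thesis by linarith
  qed
  ultimately show ?thesis by blast
qed

context
  fixes x :: "real \<Rightarrow> real" and a t c :: real
  assumes "a < t" and cont: "continuous_on {a..t} x" and start: "x a < c"
begin

text \<open>At most one index is a first crossing, so at most one summand survives. Index 0 is
  excluded by \<open>x a < c\<close>, hence the sum from 1.\<close>

lemma crossing_sum:
  fixes H :: "nat \<Rightarrow> real"
  shows "(\<Sum>k\<in>{1..2 ^ n}. of_bool (first_crossing c (\<lambda>i. x (dyadic_grid a t n i)) k) * H k)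
    = (if \<exists>k\<le>2 ^ n. c \<le> x (dyadic_grid a t n k) then H (LEAST k. c \<le> x (dyadic_grid a t n k)) else 0)"
proof (cases "\<exists>k\<le>2 ^ n. c \<le> x (dyadic_grid a t n k)")
  case True
  define \<kappa> where "\<kappa> = (LEAST k. c \<le> x (dyadic_grid a t n k))"
  obtain k where k: "k \<le> 2 ^ n" "c \<le> x (dyadic_grid a t n k)"
    using True by blast
  have \<kappa>: "c \<le> x (dyadic_grid a t n \<kappa>)" "\<kappa> \<le> k"
    unfolding \<kappa>_def using k(2) by (auto intro: LeastI Least_le)
  have before: "x (dyadic_grid a t n j) < c" if "j < \<kappa>" for j
    using not_less_Least that unfolding \<kappa>_def by force
  have "\<kappa> \<noteq> 0"
    using \<kappa>(1) start by (metis dyadic_grid_simps(1) not_le)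
  have "first_crossing c (\<lambda>i. x (dyadic_grid a t n i)) j \<longleftrightarrow> j = \<kappa>" for j
    unfolding first_crossing_def using \<kappa> before by (metis linorder_neqE_nat not_le)
  then have "(\<Sum>k\<in>{1..2 ^ n}. of_bool (first_crossing c (\<lambda>i. x (dyadic_grid a t n i)) k) * H k) = (\<Sum>k\<in>{1..2 ^ n}. if k = \<kappa> then H k else 0)"
    by (intro sum.cong) auto
  also have "\<dots> = H \<kappa>"
    using \<open>\<kappa> \<noteq> 0\<close> \<kappa> k(1) by (subst sum.delta) auto
  finally show ?thesis
    using True by (simp add: \<kappa>_def)
next
  case False
  then have "\<not> first_crossing c (\<lambda>i. x (dyadic_grid a t n i)) k" if "k \<in> {1..2 ^ n}" for k
    using that by (auto simp: first_crossing_def)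
  then show ?thesis
    using False by (auto intro!: sum.neutral)
qed

text \<open>By nesting, every fine grid sees a crossing. The value at the first crossing is at least
  \<open>c\<close> and the value one mesh earlier is below \<open>c\<close>, so uniform continuity
  squeezes the former to \<open>c\<close>.\<close>

lemma tendsto_first_crossing:
  assumes crosses: "c \<le> x (dyadic_grid a t n\<^sub>0 k\<^sub>0)" "k\<^sub>0 \<le> 2 ^ n\<^sub>0"
  shows "(\<lambda>n. x (dyadic_grid a t n (LEAST k. c \<le> x (dyadic_grid a t n k)))) \<longlonglongrightarrow> c"
proof (rule LIMSEQ_I)
  fix e :: real assume "0 < e"
  have "uniformly_continuous_on {a..t} x"
    using cont by (intro compact_uniformly_continuous) auto
  then obtain d where d: "0 < d" "\<And>u v. u \<in> {a..t} \<Longrightarrow> v \<in> {a..t} \<Longrightarrow> dist u v < d \<Longrightarrow> dist (x u) (x v) < e"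
    using \<open>0 < e\<close> unfolding uniformly_continuous_on_def by (meson dist_commute)
  obtain N where N: "(t - a) / d < 2 ^ N"
    using real_arch_pow[of 2 "(t - a) / d"] by auto
  show "\<exists>no. \<forall>n\<ge>no. norm (x (dyadic_grid a t n (LEAST k. c \<le> x (dyadic_grid a t n k))) - c) < e"
  proof (intro exI allI impI)
    fix n assume "max N n\<^sub>0 \<le> n"
    then have "N \<le> n" "n\<^sub>0 \<le> n" by auto
    have "(2::real) ^ N \<le> 2 ^ n"
      using \<open>N \<le> n\<close> by (simp add: power_increasing)
    then have mesh: "(t - a) / 2 ^ n < d"
    proof -
      have "t - a < d * 2 ^ N"
        using N \<open>0 < d\<close> by (simp add: field_simps)
      also have "\<dots> \<le> d * 2 ^ n"
        using \<open>2 ^ N \<le> 2 ^ n\<close> \<open>0 < d\<close> by (intro mult_left_mono) auto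
      finally show ?thesis
        by (simp add: field_simps)
    qed
    define \<kappa> where "\<kappa> = (LEAST k. c \<le> x (dyadic_grid a t n k))"
    have k: "c \<le> x (dyadic_grid a t n (k\<^sub>0 * 2 ^ (n - n\<^sub>0)))"
      using crosses(1) dyadic_grid_refine[OF \<open>n\<^sub>0 \<le> n\<close>] by simp
    then have \<kappa>: "c \<le> x (dyadic_grid a t n \<kappa>)" "\<kappa> \<le> k\<^sub>0 * 2 ^ (n - n\<^sub>0)"
      unfolding \<kappa>_def by (rule LeastI, intro Least_le)
    have "k\<^sub>0 * 2 ^ (n - n\<^sub>0) \<le> 2 ^ n\<^sub>0 * 2 ^ (n - n\<^sub>0)"
      using crosses(2) by simp
    also have "\<dots> = (2::nat) ^ n"
      using \<open>n\<^sub>0 \<le> n\<close> by (simp flip: power_add)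
    finally have "\<kappa> \<le> 2 ^ n"
      using \<kappa>(2) by linarith
    have "\<kappa> \<noteq> 0"
      using \<kappa>(1) start by (metis dyadic_grid_simps(1) not_le)
    then have "x (dyadic_grid a t n (\<kappa> - 1)) < c"
      using not_less_Least[of "\<kappa> - 1" "\<lambda>k. c \<le> x (dyadic_grid a t n k)"] unfolding \<kappa>_def by force
    moreover have "dist (x (dyadic_grid a t n \<kappa>)) (x (dyadic_grid a t n (\<kappa> - 1))) < e"
    proof (rule d(2))
      show "dyadic_grid a t n \<kappa> \<in> {a..t}" "dyadic_grid a t n (\<kappa> - 1) \<in> {a..t}"
        using \<open>\<kappa> \<le> 2 ^ n\<close> \<open>a < t\<close> by (intro dyadic_grid_mem; simp)+
      have "dyadic_grid a t n \<kappa> - dyadic_grid a t n (\<kappa> - 1) = (t - a) / 2 ^ n"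
        using \<open>\<kappa> \<noteq> 0\<close> by (simp add: dyadic_grid_def of_nat_diff field_simps)
      then show "dist (dyadic_grid a t n \<kappa>) (dyadic_grid a t n (\<kappa> - 1)) < d"
        using mesh \<open>a < t\<close> by (simp add: dist_real_def)
    qed
    ultimately show "norm (x (dyadic_grid a t n (LEAST k. c \<le> x (dyadic_grid a t n k))) - c) < e"
      using \<kappa>(1) unfolding \<kappa>_def by (simp add: dist_real_def)
  qed
qed

text \<open>A path that meets \<open>c\<close> from below only off the grid points contributes 0 to
  every sum, so the limit must be stated with grid points as well.\<close>

lemma tendsto_crossing_sum:
  fixes h :: "real \<Rightarrow> real"
  assumes "isCont h (x t - c)"
  shows "(\<lambda>n. \<Sum>k\<in>{1..2 ^ n}. of_bool (first_crossing c (\<lambda>i. x (dyadic_grid a t n i)) k) * h (x t - x (dyadic_grid a t n k)))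
    \<longlonglongrightarrow> of_bool (\<exists>n. \<exists>k\<le>2 ^ n. c \<le> x (dyadic_grid a t n k)) * h (x t - c)"
proof (cases "\<exists>n. \<exists>k\<le>2 ^ n. c \<le> x (dyadic_grid a t n k)")
  case True
  then obtain n\<^sub>0 k\<^sub>0 where k\<^sub>0: "c \<le> x (dyadic_grid a t n\<^sub>0 k\<^sub>0)" "k\<^sub>0 \<le> 2 ^ n\<^sub>0"
    by blast
  have "\<exists>k\<le>2 ^ n. c \<le> x (dyadic_grid a t n k)" if "n\<^sub>0 \<le> n" for n
  proof (intro exI conjI)
    show "k\<^sub>0 * 2 ^ (n - n\<^sub>0) \<le> 2 ^ n"
      using k\<^sub>0(2) that by (metis le_add_diff_inverse mult_le_mono1 power_add)
    show "c \<le> x (dyadic_grid a t n (k\<^sub>0 * 2 ^ (n - n\<^sub>0)))"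
      using k\<^sub>0(1) dyadic_grid_refine[OF that] by simp
  qed
  then have ev: "eventually (\<lambda>n. h (x t - x (dyadic_grid a t n (LEAST k. c \<le> x (dyadic_grid a t n k))))
      = (\<Sum>k\<in>{1..2 ^ n}. of_bool (first_crossing c (\<lambda>i. x (dyadic_grid a t n i)) k) * h (x t - x (dyadic_grid a t n k)))) sequentially"
    unfolding crossing_sum by (auto simp: eventually_sequentially intro!: exI[of _ n\<^sub>0])
  have "(\<lambda>n. h (x t - x (dyadic_grid a t n (LEAST k. c \<le> x (dyadic_grid a t n k))))) \<longlonglongrightarrow> h (x t - c)"
    by (intro isCont_tendsto_compose[OF assms] tendsto_intros tendsto_first_crossing[OF k\<^sub>0])
  then have "(\<lambda>n. \<Sum>k\<in>{1..2 ^ n}. of_bool (first_crossing c (\<lambda>i. x (dyadic_grid a t n i)) k) * h (x t - x (dyadic_grid a t n k))) \<longlonglongrightarrow> h (x t - c)"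
    using ev by (rule Lim_transform_eventually)
  with True show ?thesis by simp
next
  case False
  then have "(\<lambda>n. \<Sum>k\<in>{1..2 ^ n}. of_bool (first_crossing c (\<lambda>i. x (dyadic_grid a t n i)) k) * h (x t - x (dyadic_grid a t n k))) = (\<lambda>_. 0)"
    unfolding crossing_sum by (intro ext) metis
  with False show ?thesis by (simp only: tendsto_const simp_thms of_bool_eq mult_zero_left)
qed

end

section \<open>The reflection principle with drift\<close>

context drifted_brownian_motion
begin

lemma random_variable_dyadic_grid:
  assumes "0 \<le> a" "a \<le> t"
  shows "X (dyadic_grid a t n k) \<in> borel_measurable M"
  using dyadic_grid_ge[OF assms(2), of n k] assms(1) by (intro random_variable_X) linarith

text \<open>Testing grid points only makes the event a countable combination of measurable ones, and
  it is exactly the event that survives in the limit of \<open>tendsto_crossing_sum\<close>.\<close>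

definition crossing_event :: "real \<Rightarrow> real \<Rightarrow> real \<Rightarrow> 'a set" where
  "crossing_event a t c = {\<omega> \<in> space M. X a \<omega> < c \<and> (\<exists>n. \<exists>k\<le>2 ^ n. c \<le> X (dyadic_grid a t n k) \<omega>)}"

lemma crossing_event_sets:
  assumes "0 \<le> a" "a \<le> t"
  shows "crossing_event a t c \<in> events"
proof -
  note [measurable] = random_variable_dyadic_grid[OF assms] random_variable_X[OF assms(1)]
  show ?thesis unfolding crossing_event_def by measurable
qed

lemma tendsto_expectation_crossing_sum:
  fixes h :: "real \<Rightarrow> real"
  assumes "0 < a" "a < t" and cont: "\<And>z. isCont h z" and bound: "\<And>z. \<bar>h z\<bar> \<le> K"
  shows "(\<lambda>n. \<Sum>k\<in>{1..2 ^ n}. expectation (\<lambda>\<omega>. of_bool (first_crossing c (\<lambda>j. X (dyadic_grid a t n j) \<omega>) k)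
      * h (X t \<omega> - X (dyadic_grid a t n k) \<omega>)))
    \<longlonglongrightarrow> expectation (\<lambda>\<omega>. indicator (crossing_event a t c) \<omega> * h (X t \<omega> - c))"
proof -
  let ?S = "\<lambda>n \<omega>. \<Sum>k\<in>{1..2 ^ n}. of_bool (first_crossing c (\<lambda>j. X (dyadic_grid a t n j) \<omega>) k) * h (X t \<omega> - X (dyadic_grid a t n k) \<omega>)"
  have "continuous_on UNIV h"
    using cont by (simp add: continuous_at_imp_continuous_on)
  then have [measurable]: "h \<in> borel_measurable borel"
    by (rule borel_measurable_continuous_onI)
  have [measurable]: "X (dyadic_grid a t n k) \<in> borel_measurable M" "X a \<in> borel_measurable M" "X t \<in> borel_measurable M"
      "crossing_event a t c \<in> events" for n k
    using assms by (simp_all add: random_variable_dyadic_grid random_variable_X crossing_event_sets)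
  have [measurable]: "Measurable.pred M (\<lambda>\<omega>. first_crossing c (\<lambda>j. X (dyadic_grid a t n j) \<omega>) k)" for n k
    using dyadic_grid_ge[of a t n] assms by (intro first_crossing_measurable) (meson less_imp_le order_trans)
  have F: "(\<lambda>\<omega>. of_bool (first_crossing c (\<lambda>j. X (dyadic_grid a t n j) \<omega>) k) * h (X t \<omega> - X (dyadic_grid a t n k) \<omega>)) \<in> borel_measurable M" for n k
    unfolding of_bool_def by measurable
  have "0 \<le> K"
    using bound[of 0] by linarith
  have path: "continuous_on {a..t} (\<lambda>s. X s \<omega>)" if "\<omega> \<in> space M" for \<omega>
    using continuous_paths[OF that] by (rule continuous_on_subset) (use assms in auto)
  \<comment> \<open>A path already at or above \<open>c\<close> at time \<open>a\<close> has its
    first crossing at index 0, which the sums omit.\<close>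
  have late: "\<not> first_crossing c (\<lambda>j. X (dyadic_grid a t n j) \<omega>) k" if "c \<le> X a \<omega>" "k \<in> {1..2 ^ n}" for n k \<omega>
  proof
    assume "first_crossing c (\<lambda>j. X (dyadic_grid a t n j) \<omega>) k"
    moreover have "0 < k"
      using that(2) by simp
    ultimately have "X (dyadic_grid a t n 0) \<omega> < c"
      unfolding first_crossing_def by blast
    with that(1) show False by simp
  qed
  have "(\<lambda>n. expectation (?S n)) \<longlonglongrightarrow> expectation (\<lambda>\<omega>. indicator (crossing_event a t c) \<omega> * h (X t \<omega> - c))"
  proof (rule integral_dominated_convergence[where w = "\<lambda>_. K"])
    show "AE \<omega> in M. (\<lambda>n. ?S n \<omega>) \<longlonglongrightarrow> indicator (crossing_event a t c) \<omega> * h (X t \<omega> - c)"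
    proof (rule AE_I2)
      fix \<omega> assume \<omega>: "\<omega> \<in> space M"
      show "(\<lambda>n. ?S n \<omega>) \<longlonglongrightarrow> indicator (crossing_event a t c) \<omega> * h (X t \<omega> - c)"
      proof (cases "X a \<omega> < c")
        case True
        then have "indicator (crossing_event a t c) \<omega> = (of_bool (\<exists>n. \<exists>k\<le>2 ^ n. c \<le> X (dyadic_grid a t n k) \<omega>) :: real)"
          using \<omega> by (simp add: crossing_event_def indicator_def)
        then show ?thesis
          using tendsto_crossing_sum[OF \<open>a < t\<close> path[OF \<omega>] True cont] by simp
      next
        case False
        then have "?S n \<omega> = 0" for n
          using late by (intro sum.neutral) auto
        moreover have "\<omega> \<notin> crossing_event a t c"
          using False by (simp add: crossing_event_def)
        ultimately show ?thesis by simp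
      qed
    qed
    show "AE \<omega> in M. norm (?S n \<omega>) \<le> K" for n
    proof (rule AE_I2)
      fix \<omega> assume \<omega>: "\<omega> \<in> space M"
      show "norm (?S n \<omega>) \<le> K"
      proof (cases "X a \<omega> < c")
        case True
        then show ?thesis
          unfolding crossing_sum[OF \<open>a < t\<close> path[OF \<omega>] True] using bound \<open>0 \<le> K\<close> by simp
      next
        case False
        then have "?S n \<omega> = 0"
          using late by (intro sum.neutral) auto
        then show ?thesis using \<open>0 \<le> K\<close> by simp
      qed
    qed
    show "?S n \<in> borel_measurable M" for n
      by (intro borel_measurable_sum F)
    show "(\<lambda>\<omega>. indicator (crossing_event a t c) \<omega> * h (X t \<omega> - c)) \<in> borel_measurable M"
      by measurable
  qed simp
  moreover have "expectation (?S n) = (\<Sum>k\<in>{1..2 ^ n}. expectation (\<lambda>\<omega>. of_bool (first_crossing c (\<lambda>j. X (dyadic_grid a t n j) \<omega>) k)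
      * h (X t \<omega> - X (dyadic_grid a t n k) \<omega>)))" for n
  proof (rule Bochner_Integration.integral_sum)
    fix k
    show "integrable M (\<lambda>\<omega>. of_bool (first_crossing c (\<lambda>j. X (dyadic_grid a t n j) \<omega>) k) * h (X t \<omega> - X (dyadic_grid a t n k) \<omega>))"
      by (rule integrable_const_bound[where B = K, OF _ F]) (use bound \<open>0 \<le> K\<close> in \<open>auto simp: of_bool_def\<close>)
  qed
  ultimately show ?thesis by simp
qed

text \<open>The grid identities are summed and the mesh tends to 0. Continuity of \<open>h\<close>
  enters because the value at the first crossing only tends to \<open>c\<close>.\<close>

lemma expectation_reflection:
  fixes h :: "real \<Rightarrow> real"
  assumes "0 < a" "a < t" and cont: "\<And>z. isCont h z" and bound: "\<And>z. \<bar>h z\<bar> \<le> K"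
    and bound': "\<And>z. \<bar>h (- z) * exp (- 2 * \<mu> * z)\<bar> \<le> K"
  shows "expectation (\<lambda>\<omega>. indicator (crossing_event a t c) \<omega> * h (X t \<omega> - c))
    = expectation (\<lambda>\<omega>. indicator (crossing_event a t c) \<omega> * (h (- (X t \<omega> - c)) * exp (- 2 * \<mu> * (X t \<omega> - c))))"
proof -
  let ?h' = "\<lambda>z. h (- z) * exp (- 2 * \<mu> * z)"
  have cont': "isCont ?h' z" for z
    by (intro continuous_intros isCont_o2[OF _ cont])
  have "continuous_on UNIV h"
    using cont by (simp add: continuous_at_imp_continuous_on)
  then have h: "h \<in> borel_measurable borel"
    by (rule borel_measurable_continuous_onI)
  have "expectation (\<lambda>\<omega>. of_bool (first_crossing c (\<lambda>j. X (dyadic_grid a t n j) \<omega>) k) * h (X t \<omega> - X (dyadic_grid a t n k) \<omega>))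
    = expectation (\<lambda>\<omega>. of_bool (first_crossing c (\<lambda>j. X (dyadic_grid a t n j) \<omega>) k) * ?h' (X t \<omega> - X (dyadic_grid a t n k) \<omega>))"
    if "k \<in> {1..2 ^ n}" for n k
    using first_crossing_reflect[of "dyadic_grid a t n" "2 ^ n" k h K c] dyadic_grid_less_iff[OF \<open>a < t\<close>] that assms h
    by simp
  then have eq: "(\<Sum>k\<in>{1..2 ^ n}. expectation (\<lambda>\<omega>. of_bool (first_crossing c (\<lambda>j. X (dyadic_grid a t n j) \<omega>) k) * h (X t \<omega> - X (dyadic_grid a t n k) \<omega>)))
    = (\<Sum>k\<in>{1..2 ^ n}. expectation (\<lambda>\<omega>. of_bool (first_crossing c (\<lambda>j. X (dyadic_grid a t n j) \<omega>) k) * ?h' (X t \<omega> - X (dyadic_grid a t n k) \<omega>)))" for n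
    by (intro sum.cong) auto
  show ?thesis
    using tendsto_expectation_crossing_sum[OF assms(1,2) cont bound, of c]
      tendsto_expectation_crossing_sum[OF assms(1,2) cont' bound', of c]
    unfolding eq by (rule LIMSEQ_unique)
qed

text \<open>Reflection turns a path that ends below \<open>c\<close> into one that ends above it,
  and such a path must have crossed. The crossing event thus disappears and only \<open>X a\<close>
  and \<open>X t\<close> remain.\<close>

lemma expectation_crossing_below:
  assumes "0 < a" "a < t"
  shows "expectation (\<lambda>\<omega>. indicator (crossing_event a t c) \<omega> * of_bool (X t \<omega> < c))
    = expectation (\<lambda>\<omega>. of_bool (X a \<omega> < c \<and> c < X t \<omega>) * exp (- 2 * \<mu> * (X t \<omega> - c)))"
proof -
  \<comment> \<open>Continuous functions that vanish outside the interval from \<open>- m\<close> to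
    0 and tend to the indicator of the negative half-line. The bounded support keeps
    \<open>h m (- z) * exp (- 2 * \<mu> * z)\<close> bounded, as
    \<open>expectation_reflection\<close> demands.\<close>
  define h where "h m z = max 0 (min 1 (real m * min (- z) (real m + z)))" for m z
  have h_cont: "isCont (h m) z" for m z
    unfolding h_def by (intro continuous_intros)
  then have "continuous_on UNIV (h m)" for m
    by (simp add: continuous_at_imp_continuous_on)
  then have [measurable]: "h m \<in> borel_measurable borel" for m
    by (rule borel_measurable_continuous_onI)
  have [measurable]: "X a \<in> borel_measurable M" "X t \<in> borel_measurable M" "crossing_event a t c \<in> events"
    using assms by (simp_all add: random_variable_X crossing_event_sets)
  have below: "(\<lambda>\<omega>. of_bool (X t \<omega> - c < 0) :: real) \<in> borel_measurable M"
    unfolding of_bool_def by measurable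
  have above: "(\<lambda>\<omega>. of_bool (- (X t \<omega> - c) < 0) :: real) \<in> borel_measurable M"
    unfolding of_bool_def by measurable
  have h_bounds: "0 \<le> h m z" "h m z \<le> 1" for m z
    by (auto simp: h_def)
  have h_zero: "h m z = 0" if "0 \<le> z \<or> z \<le> - real m" for m z
  proof -
    have "real m * min (- z) (real m + z) \<le> 0"
      using that by (intro mult_nonneg_nonpos) auto
    then show ?thesis by (simp add: h_def)
  qed
  have h_lim: "(\<lambda>m. h m z) \<longlonglongrightarrow> of_bool (z < 0)" for z
  proof (cases "z < 0")
    case True
    \<comment> \<open>The first bound makes \<open>- z\<close> the smaller argument of the inner
      \<open>min\<close>, the second makes its product with \<open>m\<close> at least 1.\<close>
    obtain N :: nat where N: "max (- 2 * z) (1 / (- z)) \<le> real N"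
      using real_arch_simple by blast
    have "h m z = 1" if "N \<le> m" for m
    proof -
      have m: "- 2 * z \<le> real m" "1 / (- z) \<le> real m"
        using N that by linarith+
      then have "1 \<le> real m * (- z)"
        using True by (simp add: field_simps)
      also have "\<dots> = real m * min (- z) (real m + z)"
        using m(1) by (simp add: min_def)
      finally show ?thesis by (simp add: h_def)
    qed
    then have "eventually (\<lambda>m. h m z = 1) sequentially"
      by (auto simp: eventually_sequentially)
    then show ?thesis
      using True by (auto intro: tendsto_eventually)
  next
    case False
    then show ?thesis using h_zero by simp
  qed
  have h_le: "\<bar>h m z\<bar> \<le> exp (2 * \<bar>\<mu>\<bar> * real m)" for m z
  proof -
    have "\<bar>h m z\<bar> \<le> 1"
      using h_bounds by simp
    also have "\<dots> \<le> exp (2 * \<bar>\<mu>\<bar> * real m)"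
      by simp
    finally show ?thesis .
  qed
  have h_exp_le: "\<bar>h m (- z) * exp (- 2 * \<mu> * z)\<bar> \<le> exp (2 * \<bar>\<mu>\<bar> * real m)" for m z
  proof (cases "0 \<le> - z \<or> - z \<le> - real m")
    case False
    have "- \<mu> * z \<le> \<bar>\<mu>\<bar> * z"
      using False by (intro mult_right_mono) auto
    also have "\<dots> \<le> \<bar>\<mu>\<bar> * real m"
      using False by (intro mult_left_mono) auto
    finally have "h m (- z) * exp (- 2 * \<mu> * z) \<le> 1 * exp (2 * \<bar>\<mu>\<bar> * real m)"
      using h_bounds by (intro mult_mono) auto
    then show ?thesis
      using h_bounds by (simp add: abs_mult)
  qed (simp add: h_zero)
  have reflect: "expectation (\<lambda>\<omega>. indicator (crossing_event a t c) \<omega> * h m (X t \<omega> - c))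
    = expectation (\<lambda>\<omega>. indicator (crossing_event a t c) \<omega> * (h m (- (X t \<omega> - c)) * exp (- 2 * \<mu> * (X t \<omega> - c))))" for m
    by (rule expectation_reflection[OF assms h_cont h_le h_exp_le])
  have "(\<lambda>m. expectation (\<lambda>\<omega>. indicator (crossing_event a t c) \<omega> * h m (X t \<omega> - c)))
    \<longlonglongrightarrow> expectation (\<lambda>\<omega>. indicator (crossing_event a t c) \<omega> * of_bool (X t \<omega> - c < 0))"
  proof (rule integral_dominated_convergence[where w = "\<lambda>_. 1"])
    show "AE \<omega> in M. norm (indicator (crossing_event a t c) \<omega> * h m (X t \<omega> - c)) \<le> 1" for m
      using h_bounds by (auto simp: indicator_def)
    show "AE \<omega> in M. (\<lambda>m. indicator (crossing_event a t c) \<omega> * h m (X t \<omega> - c))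
        \<longlonglongrightarrow> indicator (crossing_event a t c) \<omega> * of_bool (X t \<omega> - c < 0)"
      by (intro AE_I2 tendsto_intros h_lim)
    show "(\<lambda>\<omega>. indicator (crossing_event a t c) \<omega> * of_bool (X t \<omega> - c < 0) :: real) \<in> borel_measurable M"
      by (intro borel_measurable_times below) measurable
    show "(\<lambda>\<omega>. indicator (crossing_event a t c) \<omega> * h m (X t \<omega> - c)) \<in> borel_measurable M" for m
      by measurable
  qed simp
  moreover have "(\<lambda>m. expectation (\<lambda>\<omega>. indicator (crossing_event a t c) \<omega> * (h m (- (X t \<omega> - c)) * exp (- 2 * \<mu> * (X t \<omega> - c)))))
    \<longlonglongrightarrow> expectation (\<lambda>\<omega>. indicator (crossing_event a t c) \<omega> * (of_bool (- (X t \<omega> - c) < 0) * exp (- 2 * \<mu> * (X t \<omega> - c))))"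
  proof (rule integral_dominated_convergence[where w = "\<lambda>\<omega>. exp (2 * \<mu> * c) * exp (- 2 * \<mu> * X t \<omega>)"])
    show "AE \<omega> in M. norm (indicator (crossing_event a t c) \<omega> * (h m (- (X t \<omega> - c)) * exp (- 2 * \<mu> * (X t \<omega> - c))))
        \<le> exp (2 * \<mu> * c) * exp (- 2 * \<mu> * X t \<omega>)" for m
    proof (rule AE_I2)
      fix \<omega>
      have "h m (- (X t \<omega> - c)) * exp (- 2 * \<mu> * (X t \<omega> - c)) \<le> 1 * exp (- 2 * \<mu> * (X t \<omega> - c))"
        using h_bounds by (intro mult_right_mono) auto
      also have "\<dots> = exp (2 * \<mu> * c) * exp (- 2 * \<mu> * X t \<omega>)"
        by (simp add: algebra_simps flip: exp_add)
      finally show "norm (indicator (crossing_event a t c) \<omega> * (h m (- (X t \<omega> - c)) * exp (- 2 * \<mu> * (X t \<omega> - c))))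
        \<le> exp (2 * \<mu> * c) * exp (- 2 * \<mu> * X t \<omega>)"
        using h_bounds by (simp add: indicator_def abs_mult)
    qed
    show "AE \<omega> in M. (\<lambda>m. indicator (crossing_event a t c) \<omega> * (h m (- (X t \<omega> - c)) * exp (- 2 * \<mu> * (X t \<omega> - c))))
        \<longlonglongrightarrow> indicator (crossing_event a t c) \<omega> * (of_bool (- (X t \<omega> - c) < 0) * exp (- 2 * \<mu> * (X t \<omega> - c)))"
      by (intro AE_I2 tendsto_intros h_lim)
    show "integrable M (\<lambda>\<omega>. exp (2 * \<mu> * c) * exp (- 2 * \<mu> * X t \<omega>))"
      using assms by (intro integrable_mult_right integrable_exp_X) simp
    show "(\<lambda>\<omega>. indicator (crossing_event a t c) \<omega> * (of_bool (- (X t \<omega> - c) < 0) * exp (- 2 * \<mu> * (X t \<omega> - c)))) \<in> borel_measurable M"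
      by (intro borel_measurable_times above) measurable
    show "(\<lambda>\<omega>. indicator (crossing_event a t c) \<omega> * (h m (- (X t \<omega> - c)) * exp (- 2 * \<mu> * (X t \<omega> - c)))) \<in> borel_measurable M" for m
      by measurable
  qed
  ultimately have "expectation (\<lambda>\<omega>. indicator (crossing_event a t c) \<omega> * of_bool (X t \<omega> - c < 0))
    = expectation (\<lambda>\<omega>. indicator (crossing_event a t c) \<omega> * (of_bool (- (X t \<omega> - c) < 0) * exp (- 2 * \<mu> * (X t \<omega> - c))))"
    unfolding reflect by (rule LIMSEQ_unique)
  also have "\<dots> = expectation (\<lambda>\<omega>. of_bool (X a \<omega> < c \<and> c < X t \<omega>) * exp (- 2 * \<mu> * (X t \<omega> - c)))"
  proof (rule Bochner_Integration.integral_cong)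
    fix \<omega> assume "\<omega> \<in> space M"
    \<comment> \<open>The grid with \<open>n = 0\<close> consists of \<open>a\<close> and
      \<open>t\<close> and already witnesses the crossing.\<close>
    moreover have "\<exists>n. \<exists>k\<le>2 ^ n. c \<le> X (dyadic_grid a t n k) \<omega>" if "c < X t \<omega>"
      using that by (intro exI[of _ 0] exI[of _ 1]) (simp add: dyadic_grid_def)
    ultimately show "indicator (crossing_event a t c) \<omega> * (of_bool (- (X t \<omega> - c) < 0) * exp (- 2 * \<mu> * (X t \<omega> - c)))
        = of_bool (X a \<omega> < c \<and> c < X t \<omega>) * exp (- 2 * \<mu> * (X t \<omega> - c))"
      by (auto simp: crossing_event_def indicator_def)
  qed simp
  finally show ?thesis by simp
qed

end

section \<open>The last zero\<close>

text \<open>Because of \<open>s < t\<close> the set of zeros need not be closed. Its closure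
  consists of zeros in the compact interval up to \<open>t\<close>, so the supremum is again a zero,
  possibly \<open>t\<close> itself.\<close>

lemma last_zero_before_properties:
  fixes x :: "real \<Rightarrow> 'b \<Rightarrow> real"
  assumes "0 < t" "x 0 \<omega> = 0" and cont: "continuous_on {0..} (\<lambda>s. x s \<omega>)"
  shows last_zero_before_mem: "last_zero_before x t \<omega> \<in> {0..t}"
    and last_zero_before_zero: "x (last_zero_before x t \<omega>) \<omega> = 0"
    and last_zero_before_upper: "\<And>s. 0 \<le> s \<Longrightarrow> s < t \<Longrightarrow> x s \<omega> = 0 \<Longrightarrow> s \<le> last_zero_before x t \<omega>"
proof -
  let ?Z = "{s. 0 \<le> s \<and> s < t \<and> x s \<omega> = 0}" and ?C = "{s \<in> {0..t}. x s \<omega> = 0}"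
  have bdd: "bdd_above ?Z"
    by (rule bdd_aboveI[of _ t]) auto
  have "0 \<in> ?Z"
    using assms by simp
  then have "Sup ?Z \<in> closure ?Z"
    using bdd by (intro closure_contains_Sup) auto
  moreover have "closed ?C"
    by (rule continuous_closed_preimage_constant) (auto intro: continuous_on_subset[OF cont])
  then have "closure ?Z \<subseteq> ?C"
    by (intro closure_minimal) auto
  ultimately have "Sup ?Z \<in> ?C" by blast
  then show "last_zero_before x t \<omega> \<in> {0..t}" "x (last_zero_before x t \<omega>) \<omega> = 0"
    by (auto simp: last_zero_before_def)
  show "\<And>s. 0 \<le> s \<Longrightarrow> s < t \<Longrightarrow> x s \<omega> = 0 \<Longrightarrow> s \<le> last_zero_before x t \<omega>"
    unfolding last_zero_before_def by (rule cSup_upper[OF _ bdd]) simp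
qed

text \<open>On a compact interval the absolute value attains its minimum, which is 0 as soon as the
  values on a dense set come arbitrarily close to 0. This describes an uncountable union by
  countably many times.\<close>

lemma exists_zero_iff_dyadic:
  fixes x :: "real \<Rightarrow> real"
  assumes "p < q" and cont: "continuous_on {p..q} x"
  shows "(\<exists>s\<in>{p..q}. x s = 0) \<longleftrightarrow> (\<forall>m. \<exists>n. \<exists>k\<le>2 ^ n. \<bar>x (dyadic_grid p q n k)\<bar> < 1 / real (Suc m))"
proof
  assume "\<exists>s\<in>{p..q}. x s = 0"
  then obtain s where s: "s \<in> {p..q}" "x s = 0" by blast
  show "\<forall>m. \<exists>n. \<exists>k\<le>2 ^ n. \<bar>x (dyadic_grid p q n k)\<bar> < 1 / real (Suc m)"
  proof
    fix m
    have "0 < 1 / real (Suc m)" by simp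
    with cont s(1) obtain d where d: "0 < d" "\<And>u. u \<in> {p..q} \<Longrightarrow> dist u s < d \<Longrightarrow> dist (x u) (x s) < 1 / real (Suc m)"
      unfolding continuous_on_iff by blast
    obtain n k where "k \<le> 2 ^ n" "\<bar>dyadic_grid p q n k - s\<bar> < d"
      using dyadic_grid_dense[OF assms(1) s(1) d(1)] by blast
    then show "\<exists>n. \<exists>k\<le>2 ^ n. \<bar>x (dyadic_grid p q n k)\<bar> < 1 / real (Suc m)"
      using d(2)[of "dyadic_grid p q n k"] dyadic_grid_mem[of p q k n] assms(1) s(2)
      by (auto simp: dist_real_def)
  qed
next
  assume *: "\<forall>m. \<exists>n. \<exists>k\<le>2 ^ n. \<bar>x (dyadic_grid p q n k)\<bar> < 1 / real (Suc m)"
  have "continuous_on {p..q} (\<lambda>s. \<bar>x s\<bar>)"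
    by (intro continuous_intros cont)
  then obtain s where s: "s \<in> {p..q}" "\<And>u. u \<in> {p..q} \<Longrightarrow> \<bar>x s\<bar> \<le> \<bar>x u\<bar>"
    using continuous_attains_inf[of "{p..q}" "\<lambda>s. \<bar>x s\<bar>"] assms(1) by auto
  have "\<bar>x s\<bar> \<le> 0"
  proof (rule ccontr)
    assume "\<not> \<bar>x s\<bar> \<le> 0"
    then obtain m where m: "1 / real (Suc m) < \<bar>x s\<bar>"
      using nat_approx_posE[of "\<bar>x s\<bar>"] by auto
    obtain n k where "k \<le> 2 ^ n" "\<bar>x (dyadic_grid p q n k)\<bar> < 1 / real (Suc m)"
      using * by blast
    then show False
      using m s(2)[of "dyadic_grid p q n k"] dyadic_grid_mem[of p q k n] assms(1) by simp
  qed
  with s(1) show "\<exists>s\<in>{p..q}. x s = 0" by auto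
qed

section \<open>Measurability of the last zero\<close>

context drifted_brownian_motion
begin

text \<open>The open interval from \<open>a\<close> to \<open>t\<close> is exhausted by compact
  ones, as needed for \<open>exists_zero_iff_dyadic\<close>.\<close>

lemma last_zero_before_greater_iff:
  assumes "0 \<le> a" "a < t" "\<omega> \<in> space M"
  shows "a < last_zero_before X t \<omega> \<longleftrightarrow>
    (\<exists>j::nat. a + 1 / real (Suc j) < t - 1 / real (Suc j) \<and>
      (\<exists>s\<in>{a + 1 / real (Suc j)..t - 1 / real (Suc j)}. X s \<omega> = 0))" (is "_ \<longleftrightarrow> ?R")
proof
  assume *: "a < last_zero_before X t \<omega>"
  let ?Z = "{s. 0 \<le> s \<and> s < t \<and> X s \<omega> = 0}"
  have "0 \<in> ?Z"
    using assms start_at_0 by simp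
  moreover have "bdd_above ?Z"
    by (rule bdd_aboveI[of _ t]) auto
  ultimately obtain s where s: "0 \<le> s" "s < t" "X s \<omega> = 0" "a < s"
    using * unfolding last_zero_before_def by (subst (asm) less_cSup_iff) auto
  define e where "e = min (s - a) (t - s)"
  have "0 < e" using s by (simp add: e_def)
  then obtain j where j: "1 / real (Suc j) < e"
    using nat_approx_posE by blast
  then show ?R
    using s by (intro exI[of _ j] conjI bexI[of _ s]) (auto simp: e_def)
next
  assume ?R
  then obtain j :: nat and s where s: "s \<in> {a + 1 / real (Suc j)..t - 1 / real (Suc j)}" "X s \<omega> = 0"
    by blast
  have "0 < 1 / real (Suc j)" by simp
  then have "a < s" "s < t" using s(1) by (simp_all only: atLeastAtMost_iff) linarith+
  then show "a < last_zero_before X t \<omega>"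
    using last_zero_before_upper[of t X \<omega> s] assms s(2) start_at_0[OF assms(3)] continuous_paths[OF assms(3)] by simp
qed

lemma borel_measurable_last_zero_before:
  assumes "0 < t"
  shows "last_zero_before X t \<in> borel_measurable M"
proof (rule borel_measurableI_greater)
  fix a
  have mem: "last_zero_before X t \<omega> \<in> {0..t}" if "\<omega> \<in> space M" for \<omega>
    using last_zero_before_mem[where x = X and \<omega> = \<omega> and t = t] assms start_at_0[OF that] continuous_paths[OF that] by blast
  consider "a < 0" | "t \<le> a" | "0 \<le> a" "a < t" by linarith
  then show "{\<omega> \<in> space M. a < last_zero_before X t \<omega>} \<in> sets M"
  proof cases
    case 1
    then have "{\<omega> \<in> space M. a < last_zero_before X t \<omega>} = space M"
      using mem by fastforce
    then show ?thesis by simp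
  next
    case 2
    then have "{\<omega> \<in> space M. a < last_zero_before X t \<omega>} = {}"
      using mem by fastforce
    then show ?thesis by (simp only: sets.empty_sets)
  next
    case 3
    let ?p = "\<lambda>j::nat. a + 1 / real (Suc j)" and ?q = "\<lambda>j::nat. t - 1 / real (Suc j)"
    have path: "continuous_on {?p j..?q j} (\<lambda>s. X s \<omega>)" if "\<omega> \<in> space M" for j \<omega>
      using 3(1) by (intro continuous_on_subset[OF continuous_paths[OF that]]) (auto intro: order_trans[rotated] add_nonneg_nonneg)
    have "a < last_zero_before X t \<omega> \<longleftrightarrow>
        (\<exists>j. ?p j < ?q j \<and> (\<forall>m. \<exists>n. \<exists>k\<le>2 ^ n. \<bar>X (dyadic_grid (?p j) (?q j) n k) \<omega>\<bar> < 1 / real (Suc m)))"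
      if "\<omega> \<in> space M" for \<omega>
      unfolding last_zero_before_greater_iff[OF 3 that] using exists_zero_iff_dyadic[OF _ path[OF that]] by blast
    then have "{\<omega> \<in> space M. a < last_zero_before X t \<omega>} =
      (\<Union>j\<in>{j. ?p j < ?q j}. {\<omega> \<in> space M. \<forall>m. \<exists>n. \<exists>k\<le>2 ^ n. \<bar>X (dyadic_grid (?p j) (?q j) n k) \<omega>\<bar> < 1 / real (Suc m)})"
      by blast
    also have "\<dots> \<in> sets M"
    proof (rule sets.countable_UN'')
      fix j assume "j \<in> {j. ?p j < ?q j}"
      then have [measurable]: "X (dyadic_grid (?p j) (?q j) n k) \<in> borel_measurable M" for n k
        using 3(1) by (intro random_variable_dyadic_grid) (auto intro: add_nonneg_nonneg)
      show "{\<omega> \<in> space M. \<forall>m. \<exists>n. \<exists>k\<le>2 ^ n. \<bar>X (dyadic_grid (?p j) (?q j) n k) \<omega>\<bar> < 1 / real (Suc m)} \<in> sets M"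
        by measurable
    qed simp
    finally show ?thesis .
  qed
qed

section \<open>Probabilities of crossing and touching\<close>

text \<open>By reflection, the paths that reach \<open>c\<close> and end below it are accounted for by the first summand.\<close>

definition crossing_weight :: "real \<Rightarrow> real \<Rightarrow> real \<Rightarrow> 'a \<Rightarrow> real" where
  "crossing_weight a t c \<omega> =
    of_bool (X a \<omega> < c \<and> c < X t \<omega>) * exp (- 2 * \<mu> * (X t \<omega> - c)) + of_bool (X a \<omega> < c \<and> c \<le> X t \<omega>)"

lemma crossing_weight_measurable:
  assumes "0 \<le> a" "a \<le> t"
  shows "crossing_weight a t c \<in> borel_measurable M"
proof -
  have [measurable]: "X a \<in> borel_measurable M" "X t \<in> borel_measurable M"
    using assms by (simp_all add: random_variable_X)
  show ?thesis
    unfolding crossing_weight_def of_bool_def by measurable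
qed

text \<open>The bound is uniform in \<open>c\<close>, so one integrable majorant serves all levels
  \<open>- (1 / real (Suc m))\<close> tending to 0.\<close>

lemma crossing_weight_bounds:
  assumes "\<bar>c\<bar> \<le> 1"
  shows "0 \<le> crossing_weight a t c \<omega>" "crossing_weight a t c \<omega> \<le> exp (2 * \<bar>\<mu>\<bar>) * exp (- 2 * \<mu> * X t \<omega>) + 1"
proof -
  show "0 \<le> crossing_weight a t c \<omega>"
    by (simp add: crossing_weight_def)
  have "\<mu> * c \<le> \<bar>\<mu>\<bar> * 1"
  proof -
    have "\<mu> * c \<le> \<bar>\<mu>\<bar> * \<bar>c\<bar>"
      by (simp flip: abs_mult)
    also have "\<dots> \<le> \<bar>\<mu>\<bar> * 1"
      using assms by (intro mult_left_mono) auto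
    finally show ?thesis .
  qed
  then have "exp (- 2 * \<mu> * (X t \<omega> - c)) \<le> exp (2 * \<bar>\<mu>\<bar> + - 2 * \<mu> * X t \<omega>)"
    by (simp add: algebra_simps)
  then have "of_bool (X a \<omega> < c \<and> c < X t \<omega>) * exp (- 2 * \<mu> * (X t \<omega> - c)) \<le> exp (2 * \<bar>\<mu>\<bar>) * exp (- 2 * \<mu> * X t \<omega>)"
    by (simp add: exp_add[symmetric] of_bool_def)
  then show "crossing_weight a t c \<omega> \<le> exp (2 * \<bar>\<mu>\<bar>) * exp (- 2 * \<mu> * X t \<omega>) + 1"
    unfolding crossing_weight_def by (intro add_mono) auto
qed

lemma integrable_crossing_weight:
  assumes "0 < a" "a < t" "\<bar>c\<bar> \<le> 1"
  shows "integrable M (crossing_weight a t c)"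
proof (rule Bochner_Integration.integrable_bound)
  show "integrable M (\<lambda>\<omega>. exp (2 * \<bar>\<mu>\<bar>) * exp (- 2 * \<mu> * X t \<omega>) + 1)"
    using assms by (intro Bochner_Integration.integrable_add integrable_mult_right integrable_exp_X) auto
  show "AE \<omega> in M. norm (crossing_weight a t c \<omega>) \<le> norm (exp (2 * \<bar>\<mu>\<bar>) * exp (- 2 * \<mu> * X t \<omega>) + 1)"
    using crossing_weight_bounds[OF assms(3)] by (intro AE_I2) (smt (verit) real_norm_def)
qed (use assms in \<open>simp add: crossing_weight_measurable\<close>)

text \<open>Paths ending at or above \<open>c\<close> have crossed automatically, by the coarsest
  grid; those ending below are counted by \<open>expectation_crossing_below\<close>.\<close>

lemma prob_crossing_event:
  assumes "0 < a" "a < t" "\<bar>c\<bar> \<le> 1"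
  shows "prob (crossing_event a t c) = expectation (crossing_weight a t c)"
proof -
  have [measurable]: "X a \<in> borel_measurable M" "X t \<in> borel_measurable M" "crossing_event a t c \<in> events"
    using assms by (simp_all add: random_variable_X crossing_event_sets)
  have reached: "\<exists>n. \<exists>k\<le>2 ^ n. c \<le> X (dyadic_grid a t n k) \<omega>" if "c \<le> X t \<omega>" for \<omega>
    using that by (intro exI[of _ 0] exI[of _ 1]) (simp add: dyadic_grid_def)
  have int1: "integrable M (\<lambda>\<omega>. indicator (crossing_event a t c) \<omega> * of_bool (X t \<omega> < c) :: real)"
    by (rule integrable_const_bound[where B = 1]) (auto simp: indicator_def of_bool_def)
  have int2: "integrable M (\<lambda>\<omega>. of_bool (X a \<omega> < c \<and> c \<le> X t \<omega>) :: real)"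
    unfolding of_bool_def by (rule integrable_const_bound[where B = 1]) auto
  have int3: "integrable M (\<lambda>\<omega>. of_bool (X a \<omega> < c \<and> c < X t \<omega>) * exp (- 2 * \<mu> * (X t \<omega> - c)))"
    using Bochner_Integration.integrable_diff[OF integrable_crossing_weight[OF assms] int2]
    by (simp add: crossing_weight_def)
  have "prob (crossing_event a t c) = expectation (indicator (crossing_event a t c))"
    by simp
  also have "\<dots> = expectation (\<lambda>\<omega>. indicator (crossing_event a t c) \<omega> * of_bool (X t \<omega> < c) + of_bool (X a \<omega> < c \<and> c \<le> X t \<omega>))"
    by (rule Bochner_Integration.integral_cong[OF refl]) (use reached in \<open>auto simp: crossing_event_def indicator_def\<close>)
  also have "\<dots> = expectation (crossing_weight a t c)"
    unfolding Bochner_Integration.integral_add[OF int1 int2] expectation_crossing_below[OF assms(1,2)]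
      crossing_weight_def[abs_def] Bochner_Integration.integral_add[OF int3 int2] ..
  finally show ?thesis .
qed

text \<open>In contrast to \<open>crossing_event a t 0\<close>, this includes the paths that reach \<open>0\<close> from below only in the limit of grid points.\<close>

definition touching_event :: "real \<Rightarrow> real \<Rightarrow> 'a set" where
  "touching_event a t = {\<omega> \<in> space M. X a \<omega> < 0 \<and> (\<forall>m. \<exists>n. \<exists>k\<le>2 ^ n. - (1 / real (Suc m)) \<le> X (dyadic_grid a t n k) \<omega>)}"

lemma touching_event_sets:
  assumes "0 \<le> a" "a \<le> t"
  shows "touching_event a t \<in> events"
proof -
  note [measurable] = random_variable_dyadic_grid[OF assms] random_variable_X[OF assms(1)]
  show ?thesis unfolding touching_event_def by measurable
qed

text \<open>A touching path crosses each level slightly below 0, unless it is already above that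
  level at time \<open>a\<close>. Both the crossing probabilities and this exception pass to the
  limit, because the weight is almost surely continuous in \<open>c\<close> at 0.\<close>

lemma prob_touching_event:
  assumes "0 < a" "a < t"
  shows "prob (touching_event a t) = prob (crossing_event a t 0)"
proof (rule antisym)
  have [measurable]: "X a \<in> borel_measurable M" "X t \<in> borel_measurable M" "crossing_event a t c \<in> events" "touching_event a t \<in> events" for c
    using assms by (simp_all add: random_variable_X crossing_event_sets touching_event_sets)
  have small: "\<bar>- (1 / real (Suc m))\<bar> \<le> 1" for m
    by simp
  \<comment> \<open>The exception: paths that are negative at time \<open>a\<close> but not below
    the level, and hence outside the crossing event by definition.\<close>
  let ?N = "\<lambda>m. {\<omega> \<in> space M. - (1 / real (Suc m)) \<le> X a \<omega> \<and> X a \<omega> < 0}"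
  have N: "?N m \<in> events" for m
    by measurable
  then have intN: "integrable M (indicator (?N m) :: _ \<Rightarrow> real)" for m
    by (simp add: less_top[symmetric] del: of_nat_Suc)
  let ?\<phi> = "\<lambda>m \<omega>. crossing_weight a t (- (1 / real (Suc m))) \<omega> + indicator (?N m) \<omega>"
  have le: "prob (touching_event a t) \<le> expectation (?\<phi> m)" for m
  proof -
    have "touching_event a t \<subseteq> crossing_event a t (- (1 / real (Suc m))) \<union> ?N m"
      unfolding touching_event_def crossing_event_def by (auto simp: not_less simp del: of_nat_Suc)
    then have "prob (touching_event a t) \<le> prob (crossing_event a t (- (1 / real (Suc m))) \<union> ?N m)"
      by (intro finite_measure_mono) measurable
    also have "\<dots> \<le> prob (crossing_event a t (- (1 / real (Suc m)))) + prob (?N m)"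
      by (rule measure_Un_le) measurable
    also have "\<dots> = expectation (?\<phi> m)"
      unfolding Bochner_Integration.integral_add[OF integrable_crossing_weight[OF assms small] intN] prob_crossing_event[OF assms small]
      by (simp add: Int_absorb1 del: of_nat_Suc)
    finally show ?thesis .
  qed
  have lim: "(\<lambda>m. expectation (?\<phi> m)) \<longlonglongrightarrow> expectation (crossing_weight a t 0)"
  proof (rule integral_dominated_convergence[where w = "\<lambda>\<omega>. (exp (2 * \<bar>\<mu>\<bar>) * exp (- 2 * \<mu> * X t \<omega>) + 1) + 1"])
    show "integrable M (\<lambda>\<omega>. (exp (2 * \<bar>\<mu>\<bar>) * exp (- 2 * \<mu> * X t \<omega>) + 1) + 1)"
      using assms by (intro Bochner_Integration.integrable_add integrable_mult_right integrable_exp_X) auto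
    show "AE \<omega> in M. norm (?\<phi> m \<omega>) \<le> (exp (2 * \<bar>\<mu>\<bar>) * exp (- 2 * \<mu> * X t \<omega>) + 1) + 1" for m
    proof (rule AE_I2)
      fix \<omega>
      have "norm (?\<phi> m \<omega>) = ?\<phi> m \<omega>"
        using crossing_weight_bounds(1)[OF small] by (simp del: of_nat_Suc)
      also have "\<dots> \<le> (exp (2 * \<bar>\<mu>\<bar>) * exp (- 2 * \<mu> * X t \<omega>) + 1) + 1"
        by (intro add_mono crossing_weight_bounds(2)[OF small]) (simp add: indicator_def)
      finally show "norm (?\<phi> m \<omega>) \<le> (exp (2 * \<bar>\<mu>\<bar>) * exp (- 2 * \<mu> * X t \<omega>) + 1) + 1" .
    qed
    have pos: "0 < t" using assms by simp
    show "AE \<omega> in M. (\<lambda>m. ?\<phi> m \<omega>) \<longlonglongrightarrow> crossing_weight a t 0 \<omega>"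
      using AE_X_neq[OF assms(1), of 0] AE_X_neq[OF pos, of 0] AE_space
    proof eventually_elim
      case (elim \<omega>)
      have lim: "(\<lambda>m. - (1 / real (Suc m))) \<longlonglongrightarrow> 0"
        using tendsto_minus[OF LIMSEQ_Suc[OF lim_1_over_n]] by simp
      have ev: "eventually (\<lambda>m. 1 / real (Suc m) < e) sequentially" if "0 < e" for e
        using tendstoD[OF lim that] by (simp add: dist_real_def del: of_nat_Suc)
      \<comment> \<open>Once \<open>1 / real (Suc m)\<close> is below
        \<open>\<bar>X a \<omega>\<bar>\<close> and \<open>\<bar>X t \<omega>\<bar>\<close>, the
        level lies on the same side of both values as 0 does, and the path is outside
        \<open>?N m\<close>.\<close>
      have "eventually (\<lambda>m. of_bool (X a \<omega> < 0 \<and> 0 < X t \<omega>) * (exp (- 2 * \<mu> * (X t \<omega> - - (1 / real (Suc m)))) + 1) = ?\<phi> m \<omega>) sequentially"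
        using ev[OF zero_less_abs_iff[THEN iffD2, OF elim(1)]] ev[OF zero_less_abs_iff[THEN iffD2, OF elim(2)]]
      proof eventually_elim
        case (elim m)
        define d where "d = 1 / real (Suc m)"
        have "0 < d" "d < \<bar>X a \<omega>\<bar>" "d < \<bar>X t \<omega>\<bar>"
          using elim by (simp_all add: d_def)
        then show ?case
          unfolding crossing_weight_def d_def[symmetric]
          by (cases "X a \<omega> < 0"; cases "0 < X t \<omega>") (auto simp: indicator_def)
      qed
      moreover have "(\<lambda>m. of_bool (X a \<omega> < 0 \<and> 0 < X t \<omega>) * (exp (- 2 * \<mu> * (X t \<omega> - - (1 / real (Suc m)))) + 1))
        \<longlonglongrightarrow> of_bool (X a \<omega> < 0 \<and> 0 < X t \<omega>) * (exp (- 2 * \<mu> * (X t \<omega> - 0)) + 1)"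
        by (intro tendsto_intros lim)
      ultimately have "(\<lambda>m. ?\<phi> m \<omega>) \<longlonglongrightarrow> of_bool (X a \<omega> < 0 \<and> 0 < X t \<omega>) * (exp (- 2 * \<mu> * (X t \<omega> - 0)) + 1)"
        by (rule Lim_transform_eventually[rotated])
      also have "of_bool (X a \<omega> < 0 \<and> 0 < X t \<omega>) * (exp (- 2 * \<mu> * (X t \<omega> - 0)) + 1) = crossing_weight a t 0 \<omega>"
        using elim by (auto simp: crossing_weight_def)
      finally show ?case .
    qed
    show "?\<phi> m \<in> borel_measurable M" for m
      using assms by (intro borel_measurable_add crossing_weight_measurable borel_measurable_indicator N) auto
    show "crossing_weight a t 0 \<in> borel_measurable M"
      using assms by (intro crossing_weight_measurable) auto
  qed
  have "prob (touching_event a t) \<le> expectation (crossing_weight a t 0)"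
    by (rule LIMSEQ_le_const[OF lim]) (use le in blast)
  then show "prob (touching_event a t) \<le> prob (crossing_event a t 0)"
    using prob_crossing_event[OF assms, of 0] by simp
  have "crossing_event a t 0 \<subseteq> touching_event a t"
  proof
    fix \<omega> assume "\<omega> \<in> crossing_event a t 0"
    then obtain n k where "\<omega> \<in> space M" "X a \<omega> < 0" "k \<le> 2 ^ n" "0 \<le> X (dyadic_grid a t n k) \<omega>"
      unfolding crossing_event_def by blast
    moreover have "- (1 / real (Suc m)) \<le> 0" for m
      by simp
    ultimately show "\<omega> \<in> touching_event a t"
      unfolding touching_event_def by (blast intro: order_trans)
  qed
  then show "prob (crossing_event a t 0) \<le> prob (touching_event a t)"
    by (intro finite_measure_mono) measurable
qed

text \<open>The weight depends only on \<open>X a\<close> and \<open>X t\<close>, that is, on the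
  two independent normal increments over the times 0, \<open>a\<close>, \<open>t\<close>. Their
  joint density reduces the claim to \<open>nn_integral_sign_change\<close>.\<close>

lemma emeasure_crossing_event:
  assumes "0 < a" "a < t"
  shows "emeasure M (crossing_event a t 0)
    = (\<integral>\<^sup>+r\<in>{0<..<t - a}. ennreal (1 / (2 * pi * (a + r)) * sqrt (a / r) * exp (- (\<mu>\<^sup>2 / 2) * (a + r))) \<partial>lborel)"
proof -
  define \<tau> where "\<tau> i = (if i = 0 then 0 else if i = 1 then a else t)" for i :: nat
  define D where "D i \<omega> = X (\<tau> (Suc i)) \<omega> - X (\<tau> i) \<omega>" for i \<omega>
  have "indep_vars (\<lambda>_. borel) D {..<2}"
    unfolding D_def using assms by (intro independent_increments) (auto simp: \<tau>_def less_2_cases_iff)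
  then have "indep_var lborel ((\<lambda>v. v 0) \<circ> (\<lambda>\<omega>. restrict (\<lambda>i. D i \<omega>) {0})) lborel ((\<lambda>v. v 1) \<circ> (\<lambda>\<omega>. restrict (\<lambda>i. D i \<omega>) {1}))"
    by (intro indep_var_compose[OF indep_var_restrict]) auto
  then have "indep_var lborel (D 0) lborel (D 1)"
    by (simp add: comp_def)
  moreover have "distributed M lborel (D 0) (\<lambda>x. ennreal (normal_density (\<mu> * a) (sqrt a) x))"
    using normal_increments[of 0 a] assms by (simp add: D_def[abs_def] \<tau>_def)
  moreover have "distributed M lborel (D 1) (\<lambda>x. ennreal (normal_density (\<mu> * (t - a)) (sqrt (t - a)) x))"
    using normal_increments[of a t] assms by (simp add: D_def[abs_def] \<tau>_def)
  ultimately have joint: "distributed M (lborel \<Otimes>\<^sub>M lborel) (\<lambda>\<omega>. (D 0 \<omega>, D 1 \<omega>))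
      (\<lambda>(u, v). ennreal (normal_density (\<mu> * a) (sqrt a) u) * ennreal (normal_density (\<mu> * (t - a)) (sqrt (t - a)) v))"
    by (intro distributed_joint_indep lborel.sigma_finite_measure_axioms)
  \<comment> \<open>The crossing weight at level 0 in terms of the increments. Strict and weak
    inequality for \<open>X t\<close> differ on a null event only.\<close>
  define g :: "real \<times> real \<Rightarrow> ennreal" where
    "g = (\<lambda>(u, v). indicator {..<0} u * indicator {0<..} (u + v) * ennreal (1 + exp (- 2 * \<mu> * (u + v))))"
  have g: "g \<in> borel_measurable (lborel \<Otimes>\<^sub>M lborel)"
    unfolding g_def split_beta' by measurable
  have "0 < t"
    using assms by simp
  have "emeasure M (crossing_event a t 0) = ennreal (expectation (crossing_weight a t 0))"
    using prob_crossing_event[OF assms, of 0] by (simp add: emeasure_eq_measure)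
  also have "\<dots> = (\<integral>\<^sup>+\<omega>. ennreal (crossing_weight a t 0 \<omega>) \<partial>M)"
    using integrable_crossing_weight[OF assms, of 0] crossing_weight_bounds(1)[of 0]
    by (intro nn_integral_eq_integral[symmetric]) auto
  also have "\<dots> = (\<integral>\<^sup>+\<omega>. g (D 0 \<omega>, D 1 \<omega>) \<partial>M)"
  proof (rule nn_integral_cong_AE)
    show "AE \<omega> in M. ennreal (crossing_weight a t 0 \<omega>) = g (D 0 \<omega>, D 1 \<omega>)"
      using AE_X_neq[OF \<open>0 < t\<close>, of 0] AE_space
    proof eventually_elim
      case (elim \<omega>)
      then have "D 0 \<omega> = X a \<omega>" "D 0 \<omega> + D 1 \<omega> = X t \<omega>"
        by (simp_all add: D_def \<tau>_def start_at_0)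
      with elim show ?case
        by (auto simp: crossing_weight_def g_def add.commute split: split_indicator)
    qed
  qed
  also have "\<dots> = (\<integral>\<^sup>+u. \<integral>\<^sup>+v. ennreal (normal_density (\<mu> * a) (sqrt a) u) * ennreal (normal_density (\<mu> * (t - a)) (sqrt (t - a)) v)
        * g (u, v) \<partial>lborel \<partial>lborel)"
    unfolding distributed_nn_integral[OF joint g, symmetric]
    by (subst lborel.nn_integral_fst[symmetric]) (use g in \<open>auto simp: split_beta'\<close>)
  also have "\<dots> = (\<integral>\<^sup>+r\<in>{0<..<t - a}. ennreal (1 / (2 * pi * (a + r)) * sqrt (a / r) * exp (- (\<mu>\<^sup>2 / 2) * (a + r))) \<partial>lborel)"
    using nn_integral_sign_change[of a "t - a" \<mu>] assms by (simp only: g_def prod.case diff_gt_0_iff_gt)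
  finally show ?thesis .
qed

section \<open>Tail probabilities of the last zero\<close>

text \<open>The intermediate value theorem gives a zero after \<open>a\<close>. It might be
  \<open>t\<close> itself, which is not among the zeros strictly before \<open>t\<close>; hence the
  condition on \<open>X t\<close>.\<close>

lemma crossing_event_last_zero:
  assumes "0 < a" "a < t" "\<omega> \<in> crossing_event a t 0" "X t \<omega> \<noteq> 0"
  shows "a \<le> last_zero_before X t \<omega>"
proof -
  obtain n k where k: "\<omega> \<in> space M" "X a \<omega> < 0" "k \<le> 2 ^ n" "0 \<le> X (dyadic_grid a t n k) \<omega>"
    using assms(3) unfolding crossing_event_def by blast
  define d where "d = dyadic_grid a t n k"
  have d: "d \<in> {a..t}" "0 \<le> X d \<omega>"
    using dyadic_grid_mem[of a t k n] k assms by (auto simp: d_def)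
  have "continuous_on {a..d} (\<lambda>s. X s \<omega>)"
    using continuous_paths[OF k(1)] by (rule continuous_on_subset) (use assms in auto)
  then obtain s where s: "a \<le> s" "s \<le> d" "X s \<omega> = 0"
    using IVT'[of "\<lambda>s. X s \<omega>" a 0 d] d k(2) by auto
  moreover have "s \<noteq> t"
    using s assms(4) by auto
  ultimately have "s \<le> last_zero_before X t \<omega>"
    using d assms(1,2) start_at_0[OF k(1)] continuous_paths[OF k(1)] by (intro last_zero_before_upper) auto
  with s show ?thesis by simp
qed

text \<open>The last zero may lie off every grid, but nearby grid points take values arbitrarily
  close to 0, which is all that the touching event asks for.\<close>

lemma last_zero_touching_event:
  assumes "0 < a" "a < t" "\<omega> \<in> space M" "X a \<omega> < 0" "a \<le> last_zero_before X t \<omega>"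
  shows "\<omega> \<in> touching_event a t"
proof -
  define L where "L = last_zero_before X t \<omega>"
  have "0 < t" using assms by simp
  note props = \<open>0 < t\<close> start_at_0[OF assms(3)] continuous_paths[OF assms(3)]
  have L: "L \<in> {a..t}" "X L \<omega> = 0"
    using last_zero_before_mem[where x = X and \<omega> = \<omega>, OF props(1)] last_zero_before_zero[where x = X and \<omega> = \<omega>, OF props(1)]
      props assms(5) by (auto simp: L_def)
  have "\<exists>n. \<exists>k\<le>2 ^ n. - (1 / real (Suc m)) \<le> X (dyadic_grid a t n k) \<omega>" for m
  proof -
    have "continuous_on {a..t} (\<lambda>s. X s \<omega>)"
      using continuous_paths[OF assms(3)] by (rule continuous_on_subset) (use assms in auto)
    moreover have "0 < 1 / real (Suc m)" by simp
    ultimately obtain d where d: "0 < d" "\<And>u. u \<in> {a..t} \<Longrightarrow> dist u L < d \<Longrightarrow> dist (X u \<omega>) (X L \<omega>) < 1 / real (Suc m)"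
      using L(1) unfolding continuous_on_iff by blast
    obtain n k where k: "k \<le> 2 ^ n" "\<bar>dyadic_grid a t n k - L\<bar> < d"
      using dyadic_grid_dense[OF assms(2) L(1) d(1)] by blast
    then have "\<bar>X (dyadic_grid a t n k) \<omega>\<bar> < 1 / real (Suc m)"
      using d(2)[of "dyadic_grid a t n k"] dyadic_grid_mem[of a t k n] assms(2) L(2)
      by (simp add: dist_real_def del: of_nat_Suc)
    then have "- (1 / real (Suc m)) \<le> X (dyadic_grid a t n k) \<omega>"
      by linarith
    with k(1) show ?thesis by blast
  qed
  with assms show ?thesis
    unfolding touching_event_def by blast
qed

text \<open>Up to null events, the event lies between the disjoint union of the crossing events of
  \<open>X\<close> and \<open>- X\<close> and the union of their touching events. Crossing and
  touching are equally likely, so the two bounds coincide.\<close>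

lemma emeasure_last_zero_ge:
  assumes "0 < a" "a < t"
  shows "emeasure M {\<omega> \<in> space M. a \<le> last_zero_before X t \<omega>}
    = (\<integral>\<^sup>+r\<in>{0<..<t - a}. ennreal (1 / (pi * (a + r)) * sqrt (a / r) * exp (- (\<mu>\<^sup>2 / 2) * (a + r))) \<partial>lborel)"
proof -
  interpret neg: drifted_brownian_motion M "\<lambda>s \<omega>. - X s \<omega>" "- \<mu>"
    by (rule drifted_brownian_motion_uminus)
  have L_neg: "last_zero_before (\<lambda>s \<omega>. - X s \<omega>) t = last_zero_before X t"
    by (simp add: last_zero_before_def fun_eq_iff)
  have "0 < t" using assms by simp
  have [measurable]: "last_zero_before X t \<in> borel_measurable M"
    by (rule borel_measurable_last_zero_before[OF \<open>0 < t\<close>])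
  have ev: "crossing_event a t 0 \<in> events" "neg.crossing_event a t 0 \<in> events"
      "touching_event a t \<in> events" "neg.touching_event a t \<in> events"
    using assms by (simp_all add: crossing_event_sets touching_event_sets neg.crossing_event_sets neg.touching_event_sets)
  let ?H = "{\<omega> \<in> space M. a \<le> last_zero_before X t \<omega>}"
  have H: "?H \<in> events" by measurable
  have disj: "crossing_event a t 0 \<inter> neg.crossing_event a t 0 = {}"
    by (auto simp: crossing_event_def neg.crossing_event_def)
  have "prob (crossing_event a t 0) + prob (neg.crossing_event a t 0) = prob (crossing_event a t 0 \<union> neg.crossing_event a t 0)"
    by (rule finite_measure_Union[symmetric, OF ev(1,2) disj])
  also have "\<dots> \<le> prob ?H"
  proof (rule finite_measure_mono_AE[OF _ H])
    show "AE \<omega> in M. \<omega> \<in> crossing_event a t 0 \<union> neg.crossing_event a t 0 \<longrightarrow> \<omega> \<in> ?H"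
      using AE_X_neq[OF \<open>0 < t\<close>, of 0] AE_space
    proof eventually_elim
      case (elim \<omega>)
      then show ?case
        using crossing_event_last_zero[OF assms, of \<omega>] neg.crossing_event_last_zero[OF assms, of \<omega>] by (auto simp: L_neg)
    qed
  qed
  finally have lower: "prob (crossing_event a t 0) + prob (neg.crossing_event a t 0) \<le> prob ?H" .
  have "prob ?H \<le> prob (touching_event a t \<union> neg.touching_event a t)"
  proof (rule finite_measure_mono_AE)
    show "AE \<omega> in M. \<omega> \<in> ?H \<longrightarrow> \<omega> \<in> touching_event a t \<union> neg.touching_event a t"
      using AE_X_neq[OF assms(1), of 0]
    proof eventually_elim
      case (elim \<omega>)
      then show ?case
        using last_zero_touching_event[OF assms, of \<omega>] neg.last_zero_touching_event[OF assms, of \<omega>]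
        by (cases "X a \<omega> < 0") (auto simp: L_neg)
    qed
  qed (use ev in auto)
  also have "\<dots> \<le> prob (touching_event a t) + prob (neg.touching_event a t)"
    by (rule measure_Un_le[OF ev(3,4)])
  finally have "prob ?H = prob (crossing_event a t 0) + prob (neg.crossing_event a t 0)"
    using lower prob_touching_event[OF assms] neg.prob_touching_event[OF assms] by linarith
  then have "emeasure M ?H = emeasure M (crossing_event a t 0) + emeasure M (neg.crossing_event a t 0)"
    by (simp add: emeasure_eq_measure)
  also have "\<dots> = (\<integral>\<^sup>+r. 2 * (ennreal (1 / (2 * pi * (a + r)) * sqrt (a / r) * exp (- (\<mu>\<^sup>2 / 2) * (a + r))) * indicator {0<..<t - a} r) \<partial>lborel)"
    unfolding emeasure_crossing_event[OF assms] neg.emeasure_crossing_event[OF assms]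
    by (subst nn_integral_cmult, measurable, simp only: mult_2 power2_minus)
  also have "\<dots> = (\<integral>\<^sup>+r\<in>{0<..<t - a}. ennreal (1 / (pi * (a + r)) * sqrt (a / r) * exp (- (\<mu>\<^sup>2 / 2) * (a + r))) \<partial>lborel)"
  proof (rule nn_integral_cong)
    fix r :: real
    have "2 * ennreal (1 / (2 * pi * (a + r)) * sqrt (a / r) * exp (- (\<mu>\<^sup>2 / 2) * (a + r)))
      = ennreal (2 * (1 / (2 * pi * (a + r)) * sqrt (a / r) * exp (- (\<mu>\<^sup>2 / 2) * (a + r))))"
      by (simp only: ennreal_mult' [of 2] ennreal_numeral zero_le_numeral)
    then show "2 * (ennreal (1 / (2 * pi * (a + r)) * sqrt (a / r) * exp (- (\<mu>\<^sup>2 / 2) * (a + r))) * indicator {0<..<t - a} r)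
      = ennreal (1 / (pi * (a + r)) * sqrt (a / r) * exp (- (\<mu>\<^sup>2 / 2) * (a + r))) * indicator {0<..<t - a} r"
      by (simp add: mult.assoc[symmetric])
  qed
  finally show ?thesis .
qed

text \<open>The last zero is a zero of the path, and \<open>X a\<close> is almost surely
  nonzero.\<close>

lemma AE_last_zero_neq:
  assumes "0 < a" "0 < t"
  shows "AE \<omega> in M. last_zero_before X t \<omega> \<noteq> a"
  using AE_X_neq[OF assms(1), of 0] AE_space
proof eventually_elim
  case (elim \<omega>)
  then show ?case
    using last_zero_before_zero[where x = X and \<omega> = \<omega>, OF assms(2)] start_at_0[of \<omega>] continuous_paths[of \<omega>] by auto
qed

end

section \<open>The law of the last zero\<close>

definition last_zero_density :: "real \<Rightarrow> real \<Rightarrow> real \<Rightarrow> real" where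
  "last_zero_density \<mu> t a = exp (- (\<mu>\<^sup>2 * t / 2)) / (pi * sqrt (a * (t - a)))
    + \<mu>\<^sup>2 / pi * (LBINT y:{0..sqrt ((t - a) / a)}. exp (- (\<mu>\<^sup>2 * a / 2) * (1 + y\<^sup>2)))"

lemma borel_measurable_last_zero_density [measurable]: "last_zero_density \<mu> t \<in> borel_measurable borel"
proof -
  \<comment> \<open>The limit that varies with the parameter is moved into a jointly measurable
    indicator, which makes this a parameter integral over the whole line.\<close>
  have "(\<lambda>p. indicator {0..sqrt ((t - fst p) / fst p)} (snd p) *\<^sub>R exp (- (\<mu>\<^sup>2 * fst p / 2) * (1 + (snd p)\<^sup>2)))
      \<in> borel_measurable (borel \<Otimes>\<^sub>M lborel)"
    unfolding indicator_def atLeastAtMost_iff by measurable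
  then have [measurable]: "(\<lambda>a. LBINT y:{0..sqrt ((t - a) / a)}. exp (- (\<mu>\<^sup>2 * a / 2) * (1 + y\<^sup>2))) \<in> borel_measurable borel"
    unfolding set_lebesgue_integral_def
    by (intro lborel.borel_measurable_lebesgue_integral) (simp add: split_beta')
  show ?thesis
    unfolding last_zero_density_def by measurable
qed

lemma nn_integral_last_zero_density_eq:
  assumes "0 \<le> a" "a < t"
  shows "(\<integral>\<^sup>+b\<in>{a<..<t}. ennreal (last_zero_density \<mu> t b) \<partial>lborel)
    = ennreal (exp (- (\<mu>\<^sup>2 * t / 2)) / pi) * ennreal (2 * arccos (sqrt (a / t)))
      + (\<integral>\<^sup>+y\<in>{a<..<t}. ennreal (\<mu>\<^sup>2 / (2 * pi) * exp (- (\<mu>\<^sup>2 * y / 2))) * ennreal (2 * arccos (sqrt (a / y))) \<partial>lborel)"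
  unfolding nn_integral_last_zero_density[OF assms, symmetric]
proof (rule nn_integral_cong)
  fix b
  let ?f = "\<lambda>y. exp (- (\<mu>\<^sup>2 * y / 2)) / sqrt (b * (y - b))"
  let ?J = "LBINT y:{0..sqrt ((t - b) / b)}. exp (- (\<mu>\<^sup>2 * b / 2) * (1 + y\<^sup>2))"
  have "ennreal (last_zero_density \<mu> t b) = ennreal (exp (- (\<mu>\<^sup>2 * t / 2)) / (pi * sqrt (b * (t - b))))
      + (\<integral>\<^sup>+y\<in>{b<..<t}. ennreal (\<mu>\<^sup>2 / (2 * pi) * ?f y) \<partial>lborel)" if "0 < b" "b < t"
  proof -
    have "0 \<le> ?J"
      unfolding set_lebesgue_integral_def by (intro integral_nonneg_AE) auto
    have "(\<integral>\<^sup>+y\<in>{b<..<t}. ennreal (\<mu>\<^sup>2 / (2 * pi) * ?f y) \<partial>lborel)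
        = (\<integral>\<^sup>+y. ennreal (\<mu>\<^sup>2 / (2 * pi)) * (ennreal (?f y) * indicator {b<..<t} y) \<partial>lborel)"
      by (intro nn_integral_cong) (use that in \<open>auto simp flip: ennreal_mult split: split_indicator\<close>)
    also have "\<dots> = ennreal (\<mu>\<^sup>2 / (2 * pi)) * ennreal (2 * ?J)"
      by (subst nn_integral_cmult, measurable, simp only: nn_integral_last_zero_density_tail[OF that])
    also have "\<dots> = ennreal (\<mu>\<^sup>2 / pi * ?J)"
      using \<open>0 \<le> ?J\<close> by (simp flip: ennreal_mult)
    finally show ?thesis
      using that \<open>0 \<le> ?J\<close> unfolding last_zero_density_def by (subst ennreal_plus) auto
  qed
  then show "ennreal (last_zero_density \<mu> t b) * indicator {a<..<t} b
    = (ennreal (exp (- (\<mu>\<^sup>2 * t / 2)) / (pi * sqrt (b * (t - b))))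
      + (\<integral>\<^sup>+y\<in>{b<..<t}. ennreal (\<mu>\<^sup>2 / (2 * pi) * ?f y) \<partial>lborel)) * indicator {a<..<t} b"
    using assms by (cases "b \<in> {a<..<t}") auto
qed

text \<open>At \<open>a = 0\<close> every arccos is \<open>pi / 2\<close>, and the remaining
  exponential terms add up to 1 by \<open>nn_integral_exp_tail\<close> at
  \<open>x = 0\<close>.\<close>

lemma nn_integral_last_zero_density_total:
  assumes "0 < t"
  shows "(\<integral>\<^sup>+b\<in>{0<..<t}. ennreal (last_zero_density \<mu> t b) \<partial>lborel) = 1"
proof -
  have "(\<integral>\<^sup>+b\<in>{0<..<t}. ennreal (last_zero_density \<mu> t b) \<partial>lborel)
    = ennreal (exp (- (\<mu>\<^sup>2 * t / 2)) / pi) * ennreal (2 * arccos (sqrt (0 / t)))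
      + (\<integral>\<^sup>+y\<in>{0<..<t}. ennreal (\<mu>\<^sup>2 / (2 * pi) * exp (- (\<mu>\<^sup>2 * y / 2))) * ennreal (2 * arccos (sqrt (0 / y))) \<partial>lborel)"
    using assms by (intro nn_integral_last_zero_density_eq) auto
  also have "\<dots> = ennreal (exp (- (\<mu>\<^sup>2 * t / 2))) + (\<integral>\<^sup>+y\<in>{0<..<t}. ennreal (\<mu>\<^sup>2 / 2 * exp (- (\<mu>\<^sup>2 * y / 2))) \<partial>lborel)"
    by (simp flip: ennreal_mult)
  also have "\<dots> = 1"
    unfolding nn_integral_exp_tail[OF assms] by simp
  finally show ?thesis .
qed

context drifted_brownian_motion
begin

text \<open>Shifting the integration variable by \<open>a\<close> brings the tail into the form of
  \<open>nn_integral_last_zero_tail\<close>, where the two Tonelli computations meet.\<close>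

lemma emeasure_last_zero_ge_density:
  assumes "0 < a" "a < t"
  shows "emeasure M {\<omega> \<in> space M. a \<le> last_zero_before X t \<omega>}
    = (\<integral>\<^sup>+b\<in>{a<..<t}. ennreal (last_zero_density \<mu> t b) \<partial>lborel)"
proof -
  let ?f = "\<lambda>r. ennreal (1 / (pi * r) * sqrt (a / (r - a)) * exp (- (\<mu>\<^sup>2 * r / 2))) * indicator {a<..<t} r"
  have "(\<integral>\<^sup>+r. ?f r \<partial>lborel) = ennreal \<bar>1\<bar> * (\<integral>\<^sup>+r. ?f (a + 1 * r) \<partial>lborel)"
    by (rule nn_integral_real_affine) auto
  also have "\<dots> = emeasure M {\<omega> \<in> space M. a \<le> last_zero_before X t \<omega>}"
    unfolding emeasure_last_zero_ge[OF assms] by (auto intro!: nn_integral_cong split: split_indicator)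
  finally show ?thesis
    using nn_integral_last_zero_tail[OF assms] nn_integral_last_zero_density_eq[of a t \<mu>] assms by simp
qed

text \<open>Two measures with the same finite values on the open upper half-lines agree. Positive
  end points come from the tail formula and 0 from a monotone limit. Since the density has mass 1,
  the last zero is almost surely positive, and negative end points add nothing.\<close>

lemma distributed_last_zero_before:
  assumes "0 < t"
  shows "distributed M lborel (last_zero_before X t) (\<lambda>a. ennreal (indicator {0<..<t} a * last_zero_density \<mu> t a))"
proof -
  let ?L = "last_zero_before X t" and ?f = "\<lambda>a. ennreal (indicator {0<..<t} a * last_zero_density \<mu> t a)"
  have [measurable]: "?L \<in> borel_measurable M"
    by (rule borel_measurable_last_zero_before[OF assms])
  have mem: "?L \<omega> \<in> {0..t}" if "\<omega> \<in> space M" for \<omega>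
    using last_zero_before_mem[where x = X and \<omega> = \<omega> and t = t] assms start_at_0[OF that] continuous_paths[OF that] by blast
  have distr: "emeasure (distr M lborel ?L) {x<..} = emeasure M {\<omega> \<in> space M. x < ?L \<omega>}" for x
    by (simp add: emeasure_distr vimage_def Int_def conj_commute)
  have dens: "emeasure (density lborel ?f) {x<..} = (\<integral>\<^sup>+b\<in>{x<..<t}. ennreal (last_zero_density \<mu> t b) \<partial>lborel)" if "0 \<le> x" for x
    using that by (subst emeasure_density) (auto intro!: nn_integral_cong split: split_indicator)
  have pos: "emeasure (distr M lborel ?L) {x<..} = emeasure (density lborel ?f) {x<..}" if "0 < x" for x
  proof (cases "x < t")
    case True
    have "emeasure M {\<omega> \<in> space M. x < ?L \<omega>} = emeasure M {\<omega> \<in> space M. x \<le> ?L \<omega>}"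
      by (rule emeasure_eq_AE) (use AE_last_zero_neq[OF that assms] in \<open>auto elim: eventually_mono\<close>)
    then show ?thesis
      unfolding distr using dens[of x] emeasure_last_zero_ge_density[OF that True] that by simp
  next
    case False
    then have "{\<omega> \<in> space M. x < ?L \<omega>} = {}"
      using mem by fastforce
    then show ?thesis
      using False that by (simp only: distr dens) simp
  qed
  have zero: "emeasure (distr M lborel ?L) {0<..} = emeasure (density lborel ?f) {0<..}"
  proof -
    have un: "(\<Union>n. {1 / real (Suc n)<..}) = {0::real<..}"
    proof
      show "{0::real<..} \<subseteq> (\<Union>n. {1 / real (Suc n)<..})"
        using nat_approx_posE by (fastforce simp del: of_nat_Suc)
      show "(\<Union>n. {1 / real (Suc n)<..}) \<subseteq> {0::real<..}"
        by (auto intro: less_trans[rotated])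
    qed
    have inc: "incseq (\<lambda>n. {1 / real (Suc n)<..})"
      by (intro monoI) (auto simp: frac_le intro: le_less_trans[rotated])
    have "emeasure N {0<..} = (SUP n. emeasure N {1 / real (Suc n)<..})" if "sets N = sets borel" for N :: "real measure"
    proof -
      have "range (\<lambda>n. {1 / real (Suc n)<..}) \<subseteq> sets N"
        unfolding that by auto
      from SUP_emeasure_incseq[OF this inc] show ?thesis
        by (simp only: un)
    qed
    then show ?thesis
      using pos by simp
  qed
  have one: "emeasure (density lborel ?f) {0<..} = 1"
    using dens[of 0] nn_integral_last_zero_density_total[OF assms] by simp
  have neg: "emeasure (distr M lborel ?L) {x<..} = 1" "emeasure (density lborel ?f) {x<..} = 1" if "x < 0" for x
  proof -
    have "{\<omega> \<in> space M. x < ?L \<omega>} = space M"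
      using mem that by fastforce
    then show "emeasure (distr M lborel ?L) {x<..} = 1"
      unfolding distr by (simp add: emeasure_space_1)
    have "emeasure (density lborel ?f) {x<..} = emeasure (density lborel ?f) {0<..}"
      using that by (subst (1 2) emeasure_density) (auto intro!: nn_integral_cong split: split_indicator)
    then show "emeasure (density lborel ?f) {x<..} = 1"
      using one by simp
  qed
  have all: "emeasure (distr M lborel ?L) {x<..} = emeasure (density lborel ?f) {x<..}" for x
    using pos[of x] zero neg[of x] by (cases x "0::real" rule: linorder_cases) auto
  have fin: "emeasure (distr M lborel ?L) {x<..} < \<infinity>" for x
    unfolding distr by (simp add: less_top[symmetric])
  have "distr M lborel ?L = density lborel ?f"
    by (rule measure_eqI_lessThan[OF _ _ fin all]) simp_all
  then show ?thesis
    unfolding distributed_def by simp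
qed

lemma prob_last_zero_less:
  assumes "0 < a" "a < t"
  shows "prob {\<omega> \<in> space M. last_zero_before X t \<omega> < a}
    = 1 - (LBINT s:{0..t - a}. 1 / (pi * (a + s)) * sqrt (a / s) * exp (- (\<mu>\<^sup>2 / 2) * (a + s)))"
proof -
  have [measurable]: "last_zero_before X t \<in> borel_measurable M"
    using assms by (intro borel_measurable_last_zero_before) simp
  have "prob {\<omega> \<in> space M. last_zero_before X t \<omega> < a} = 1 - prob {\<omega> \<in> space M. \<not> last_zero_before X t \<omega> < a}"
    by (subst prob_neg) auto
  also have "prob {\<omega> \<in> space M. \<not> last_zero_before X t \<omega> < a}
      = (LBINT s:{0..t - a}. 1 / (pi * (a + s)) * sqrt (a / s) * exp (- (\<mu>\<^sup>2 / 2) * (a + s)))"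
    using assms
    by (subst set_integral_eq_enn2real)
      (auto simp: not_less measure_def emeasure_last_zero_ge nn_integral_Icc_eq_Ioo)
  finally show ?thesis .
qed

end

theorem theorem2p1:
  fixes M :: "'a measure" and X :: "real \<Rightarrow> 'a \<Rightarrow> real" and \<mu> t :: real
  assumes "brownian_motion_with_drift M \<mu> X"
    and "0 < t"
  shows "(\<forall>a. 0 < a \<and> a < t \<longrightarrow>
      \<P>(\<omega> in M. last_zero_before X t \<omega> < a)
        = 1 - (LBINT s:{0..t - a}.
                 1 / (pi * (a + s)) * sqrt (a / s) * exp (- (\<mu>\<^sup>2 / 2) * (a + s))) \<and>
      \<P>(\<omega> in M. last_zero_before X t \<omega> < a)
        = 1 - 2 / pi * (LBINT y:{0..sqrt ((t - a) / a)}.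
                 exp (- (\<mu>\<^sup>2 * a / 2) * (1 + y\<^sup>2)) / (1 + y\<^sup>2)) \<and>
      \<P>(\<omega> in M. last_zero_before X t \<omega> < a)
        = 1 - 2 / pi * exp (- (\<mu>\<^sup>2 * a / 2)) *
               (LBINT \<theta>:{0..arccos (sqrt (a / t))}. exp (- (\<mu>\<^sup>2 * a / 2) * (tan \<theta>)\<^sup>2)))
    \<and> distributed M lborel (last_zero_before X t)
        (\<lambda>a. ennreal (indicator {0<..<t} a *
          (exp (- (\<mu>\<^sup>2 * t / 2)) / (pi * sqrt (a * (t - a)))
            + \<mu>\<^sup>2 / pi * (LBINT y:{0..sqrt ((t - a) / a)}. exp (- (\<mu>\<^sup>2 * a / 2) * (1 + y\<^sup>2))))))
    \<and> (\<forall>a. 0 < a \<and> a < t \<longrightarrow>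
        exp (- (\<mu>\<^sup>2 * t / 2)) / (pi * sqrt (a * (t - a)))
          + \<mu>\<^sup>2 / pi * (LBINT y:{0..sqrt ((t - a) / a)}. exp (- (\<mu>\<^sup>2 * a / 2) * (1 + y\<^sup>2)))
        = exp (- (\<mu>\<^sup>2 * t / 2)) / (pi * sqrt (a * (t - a)))
          + \<mu>\<^sup>2 / (2 * pi) * (LBINT y:{a..t}. exp (- (\<mu>\<^sup>2 * y / 2)) / sqrt (a * (y - a))))"
proof -
  obtain B where B: "standard_brownian_motion M B"
    and X: "\<And>s \<omega>. 0 \<le> s \<Longrightarrow> \<omega> \<in> space M \<Longrightarrow> X s \<omega> = B s \<omega> + \<mu> * s"
    using assms(1) unfolding brownian_motion_with_drift_def by blast
  \<comment> \<open>\<open>X\<close> is tied to \<open>?Y\<close> only on the sample space and at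
    times \<open>s \<ge> 0\<close>. The last zero depends on nothing else, so it is this functional
    that is transferred rather than the process.\<close>
  let ?Y = "\<lambda>s \<omega>. B s \<omega> + \<mu> * s"
  interpret drifted_brownian_motion M ?Y \<mu>
    using B by (rule standard_brownian_motion.drifted_brownian_motion)
  have L: "last_zero_before X t \<omega> = last_zero_before ?Y t \<omega>" if "\<omega> \<in> space M" for \<omega>
  proof -
    have "{s. 0 \<le> s \<and> s < t \<and> X s \<omega> = 0} = {s. 0 \<le> s \<and> s < t \<and> ?Y s \<omega> = 0}"
      using X[OF _ that] by auto
    then show ?thesis by (simp only: last_zero_before_def)
  qed
  have prob_eq: "\<P>(\<omega> in M. last_zero_before X t \<omega> < a) = \<P>(\<omega> in M. last_zero_before ?Y t \<omega> < a)" for a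
    by (intro arg_cong[where f = prob] Collect_cong) (auto simp: L)
  have "distr M lborel (last_zero_before X t) = distr M lborel (last_zero_before ?Y t)"
    by (rule distr_cong) (simp_all add: L)
  moreover have "last_zero_before X t \<in> measurable M lborel \<longleftrightarrow> last_zero_before ?Y t \<in> measurable M lborel"
    by (rule measurable_cong) (rule L)
  ultimately have dist: "distributed M lborel (last_zero_before X t) (\<lambda>a. ennreal (indicator {0<..<t} a * last_zero_density \<mu> t a))"
    using distributed_last_zero_before[OF assms(2)] unfolding distributed_def by (simp only:)
  show ?thesis
  proof (intro conjI allI impI)
    fix a assume "0 < a \<and> a < t"
    then have a: "0 < a" "a < t" by auto
    note p = prob_last_zero_less[OF a]
    show "\<P>(\<omega> in M. last_zero_before X t \<omega> < a)
        = 1 - (LBINT s:{0..t - a}. 1 / (pi * (a + s)) * sqrt (a / s) * exp (- (\<mu>\<^sup>2 / 2) * (a + s)))"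
      unfolding prob_eq by (rule p)
    show "\<P>(\<omega> in M. last_zero_before X t \<omega> < a)
        = 1 - 2 / pi * (LBINT y:{0..sqrt ((t - a) / a)}. exp (- (\<mu>\<^sup>2 * a / 2) * (1 + y\<^sup>2)) / (1 + y\<^sup>2))"
      unfolding prob_eq p last_zero_integral_sqrt[OF a] ..
    show "\<P>(\<omega> in M. last_zero_before X t \<omega> < a)
        = 1 - 2 / pi * exp (- (\<mu>\<^sup>2 * a / 2)) * (LBINT \<theta>:{0..arccos (sqrt (a / t))}. exp (- (\<mu>\<^sup>2 * a / 2) * (tan \<theta>)\<^sup>2))"
      unfolding prob_eq p last_zero_integral_sqrt[OF a] last_zero_integral_tan[OF a] by simp
    show "exp (- (\<mu>\<^sup>2 * t / 2)) / (pi * sqrt (a * (t - a)))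
          + \<mu>\<^sup>2 / pi * (LBINT y:{0..sqrt ((t - a) / a)}. exp (- (\<mu>\<^sup>2 * a / 2) * (1 + y\<^sup>2)))
        = exp (- (\<mu>\<^sup>2 * t / 2)) / (pi * sqrt (a * (t - a)))
          + \<mu>\<^sup>2 / (2 * pi) * (LBINT y:{a..t}. exp (- (\<mu>\<^sup>2 * y / 2)) / sqrt (a * (y - a)))"
      unfolding last_zero_density_forms[OF a] ..
  qed (use dist in \<open>simp only: last_zero_density_def\<close>)
qed

end
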